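(* Let $\mathcal H$ be a real Hilbert space, let $A:\mathcal H\to2^{\mathcal H}$ be a general maximal monotone operator, and let $\gamma>0$ and $\lambda>0$ be such that $\lambda\gamma^2>1$. Assume that $S:=A^{-1}(0)=\{v\in\mathcal H:0\in Av\}$ is nonempty. Then, for all initial data $u_0,v_0\in\mathcal H$, the problem $$\ddot u(t)+\gamma\dot u(t)+A_\lambda(u(t))=0,\qquad u(0)=u_0,\ \dot u(0)=v_0,$$ where $A_\lambda$ is the Yosida approximation of index $\lambda$ of $A$, has a unique solution $u\in C^2([0,+\infty);\mathcal H)$, and it satisfies: (i1) there exists $u_\infty\in S$ such that $u(t)\rightharpoonup u_\infty$ weakly in $\mathcal H$ as $t\to+\infty$; (i2) $\dot u\in L^2(0,+\infty;\mathcal H)$ and $\lim_{t\to+\infty}|\dot u(t)|=0$.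
   Context: $|\cdot|$ denotes the norm of $\mathcal H$. For a maximal monotone operator $A$ and $\lambda>0$, the resolvent $J_\lambda^A:=(I+\lambda A)^{-1}$ is single-valued and defined on all of $\mathcal H$, and the Yosida approximation of index $\lambda$ is $A_\lambda:=\frac1\lambda(I-J^A_\lambda):\mathcal H\to\mathcal H$. *)

theory Defs
  imports "HOL-Analysis.Analysis"
begin

text \<open>
  A real Hilbert space is a type of sort \<open>{real_inner, complete_space}\<close>. A set-valued operator
  \<open>A : H \<rightarrow> 2\<^sup>H\<close> is a function \<open>A :: 'h \<Rightarrow> 'h set\<close>; its domain is \<open>{x. A x \<noteq> {}}\<close>.
\<close>

definition monotone_operator :: "('h::real_inner \<Rightarrow> 'h set) \<Rightarrow> bool" where
  "monotone_operator A \<longleftrightarrow>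
     (\<forall>x y. \<forall>a\<in>A x. \<forall>b\<in>A y. inner (a - b) (x - y) \<ge> 0)"

text \<open>Maximality is with respect to inclusion of graphs, which for functions into sets is
  pointwise inclusion.\<close>

definition maximal_monotone :: "('h::real_inner \<Rightarrow> 'h set) \<Rightarrow> bool" where
  "maximal_monotone A \<longleftrightarrow> monotone_operator A \<and>
     (\<forall>B. monotone_operator B \<and> (\<forall>x. A x \<subseteq> B x) \<longrightarrow> B = A)"

definition operator_inverse :: "('h \<Rightarrow> 'h set) \<Rightarrow> 'h \<Rightarrow> 'h set" where
  "operator_inverse A y = {x. y \<in> A x}"

text \<open>The set-valued resolvent \<open>(I + \<lambda>A)\<inverse>\<close>.\<close>

definition resolvent_set :: "real \<Rightarrow> ('h::real_inner \<Rightarrow> 'h set) \<Rightarrow> 'h \<Rightarrow> 'h set" where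
  "resolvent_set l A = operator_inverse (\<lambda>x. (\<lambda>a. x + l *\<^sub>R a) ` A x)"

text \<open>For maximal monotone \<open>A\<close> and \<open>\<lambda> > 0\<close> the set \<open>(I + \<lambda>A)\<inverse> x\<close> is a singleton for every \<open>x\<close>
  (Minty's theorem), and the following selects its element. Otherwise the value may be
  unspecified.\<close>

definition resolvent :: "real \<Rightarrow> ('h::real_inner \<Rightarrow> 'h set) \<Rightarrow> 'h \<Rightarrow> 'h" where
  "resolvent l A x = (THE y. y \<in> resolvent_set l A x)"

definition yosida :: "real \<Rightarrow> ('h::real_inner \<Rightarrow> 'h set) \<Rightarrow> 'h \<Rightarrow> 'h" where
  "yosida l A x = (1 / l) *\<^sub>R (x - resolvent l A x)"

text \<open>Time derivative on \<open>[0,\<infinity>)\<close>: two-sided for \<open>t > 0\<close> and one-sided at \<open>t = 0\<close>. Values of \<open>u\<close> at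
  negative times are irrelevant.\<close>

definition tderiv :: "(real \<Rightarrow> 'h::real_normed_vector) \<Rightarrow> real \<Rightarrow> 'h" where
  "tderiv u t = vector_derivative u (at t within {0..})"

definition C2_halfline :: "(real \<Rightarrow> 'h::real_normed_vector) \<Rightarrow> bool" where
  "C2_halfline u \<longleftrightarrow> u differentiable_on {0..} \<and> tderiv u differentiable_on {0..} \<and>
     continuous_on {0..} (tderiv (tderiv u))"

definition solves_damped_yosida ::
  "real \<Rightarrow> real \<Rightarrow> ('h::real_inner \<Rightarrow> 'h set) \<Rightarrow> 'h \<Rightarrow> 'h \<Rightarrow> (real \<Rightarrow> 'h) \<Rightarrow> bool" where
  "solves_damped_yosida g l A u0 v0 u \<longleftrightarrow> C2_halfline u \<and>
     (\<forall>t\<ge>0. tderiv (tderiv u) t + g *\<^sub>R tderiv u t + yosida l A (u t) = 0) \<and>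
     u 0 = u0 \<and> tderiv u 0 = v0"

definition weakly_tendsto :: "('a \<Rightarrow> 'h::real_inner) \<Rightarrow> 'h \<Rightarrow> 'a filter \<Rightarrow> bool" where
  "weakly_tendsto f l F \<longleftrightarrow> (\<forall>y. ((\<lambda>t. inner (f t) y) \<longlongrightarrow> inner l y) F)"

text \<open>Strong (Bochner) measurability. For a non-separable range space this is stronger than
  measurability with respect to \<open>borel\<close>.\<close>

definition strongly_measurable :: "'a measure \<Rightarrow> ('a \<Rightarrow> 'h::real_normed_vector) \<Rightarrow> bool" where
  "strongly_measurable M f \<longleftrightarrow>
     (\<exists>s. (\<forall>i::nat. simple_function M (s i)) \<and> (AE x in M. (\<lambda>i. s i x) \<longlonglongrightarrow> f x))"

definition square_integrable :: "'a measure \<Rightarrow> ('a \<Rightarrow> 'h::real_normed_vector) \<Rightarrow> bool" where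
  "square_integrable M f \<longleftrightarrow> strongly_measurable M f \<and> integrable M (\<lambda>x. (norm (f x))\<^sup>2)"

end

theory Submission
  imports Defs
begin

text \<open>
  Minty's theorem: the Fitzpatrick function \<open>F\<close> of the graph is convex and dominates the duality
  pairing, so \<open>F + \<bar>\<cdot>\<bar>\<^sup>2 / 2\<close> has a minimiser on \<open>H \<times> H\<close>; its optimality condition yields a solution
  of \<open>0 \<in> x + A x\<close>. Hence \<open>A\<^sub>\<lambda>\<close> is everywhere defined, \<open>\<lambda>\<close>-cocoercive and Lipschitz, and the Cauchy
  problem is well posed.

  For \<open>z \<in> S\<close> and \<open>h = \<bar>u - z\<bar>\<^sup>2 / 2\<close>, cocoercivity gives \<open>h'' + \<gamma> h' + \<lambda> \<bar>A\<^sub>\<lambda> u\<bar>\<^sup>2 \<le> \<bar>u'\<bar>\<^sup>2\<close>. Substituting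
  \<open>A\<^sub>\<lambda> u = - (u'' + \<gamma> u')\<close> shows that \<open>E = h' + \<gamma> h + \<lambda> \<gamma> \<bar>u'\<bar>\<^sup>2\<close> satisfies
  \<open>E' \<le> - \<lambda> \<bar>u''\<bar>\<^sup>2 - (\<lambda> \<gamma>\<^sup>2 - 1) \<bar>u'\<bar>\<^sup>2\<close>, and \<open>\<lambda> \<gamma>\<^sup>2 > 1\<close> makes \<open>E\<close> nonnegative as well. So \<open>u'\<close> and \<open>u''\<close>
  are square integrable, \<open>u' \<rightarrow> 0\<close>, \<open>A\<^sub>\<lambda> u \<rightarrow> 0\<close>, and \<open>\<bar>u - z\<bar>\<close> converges; Opial's lemma concludes.
\<close>

section \<open>Minimisation in Hilbert space and Minty's theorem\<close>

text \<open>The parallelogram identity makes the first components of a minimising sequence of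
  \<open>r + (norm w)\<^sup>2 / 2\<close> Cauchy, and closedness puts the limit in \<open>K\<close>.
  Comparison along segments then gives the variational inequality. Working with a set
  \<open>K\<close> lets epigraphs of functions with value +infinity be treated as well.\<close>

lemma quadratic_minimizer:
  fixes K :: "('a::{real_inner,complete_space} \<times> real) set"
  assumes "convex K" "closed K" "K \<noteq> {}"
    and bound: "\<And>w r. (w, r) \<in> K \<Longrightarrow> c \<le> r + (norm w)\<^sup>2 / 2"
  obtains p s where "(p, s) \<in> K" "\<And>w r. (w, r) \<in> K \<Longrightarrow> s - inner p (w - p) \<le> r"
proof -
  define \<phi> :: "'a \<times> real \<Rightarrow> real" where "\<phi> = (\<lambda>k. snd k + (norm (fst k))\<^sup>2 / 2)"
  define m where "m = Inf (\<phi> ` K)"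
  have bdd: "bdd_below (\<phi> ` K)"
    using bound by (intro bdd_belowI[of _ c]) (auto simp: \<phi>_def)
  have m_le: "m \<le> \<phi> k" if "k \<in> K" for k
    unfolding m_def using that bdd by (simp add: cInf_lower)
  have "\<exists>k\<in>K. \<phi> k < m + 1 / Suc n" for n
  proof -
    have "\<exists>y\<in>\<phi> ` K. y < m + 1 / Suc n"
      using \<open>K \<noteq> {}\<close> bdd unfolding m_def by (subst cInf_less_iff[symmetric]) auto
    then show ?thesis by auto
  qed
  then obtain k where k: "\<And>n. k n \<in> K" "\<And>n. \<phi> (k n) < m + 1 / Suc n"
    by metis
  \<comment> \<open>The midpoint of \<open>a\<close> and \<open>b\<close> lies in \<open>K\<close>,
    and \<open>\<phi>\<close> there falls below the average by one eighth of the squared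
    distance.\<close>
  have near: "(dist (fst a) (fst b))\<^sup>2 \<le> 4 * (\<phi> a + \<phi> b - 2 * m)" if "a \<in> K" "b \<in> K" for a b
  proof -
    have "m \<le> \<phi> ((1/2) *\<^sub>R a + (1/2) *\<^sub>R b)"
      using convexD[OF \<open>convex K\<close> that, of "1/2" "1/2"] by (intro m_le) auto
    also have "\<dots> = (\<phi> a + \<phi> b) / 2 - (dist (fst a) (fst b))\<^sup>2 / 8"
      by (simp add: \<phi>_def dist_norm power2_norm_eq_inner inner_simps inner_commute field_simps)
    finally show ?thesis by (simp add: field_simps)
  qed
  have lim0: "(\<lambda>n. 1 / real (Suc n)) \<longlonglongrightarrow> 0"
    using lim_inverse_n' LIMSEQ_Suc by blast
  have "Cauchy (\<lambda>n. fst (k n))"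
  proof (rule metric_CauchyI)
    fix e :: real assume "e > 0"
    have "eventually (\<lambda>n. 1 / real (Suc n) < e\<^sup>2 / 8) sequentially"
      using lim0 \<open>e > 0\<close> by (intro order_tendstoD) auto
    then obtain N where N: "\<And>n. n \<ge> N \<Longrightarrow> 1 / real (Suc n) < e\<^sup>2 / 8"
      by (auto simp: eventually_sequentially)
    show "\<exists>M. \<forall>i\<ge>M. \<forall>j\<ge>M. dist (fst (k i)) (fst (k j)) < e"
    proof (intro exI allI impI)
      fix i j assume "i \<ge> N" "j \<ge> N"
      then have "(dist (fst (k i)) (fst (k j)))\<^sup>2 < e\<^sup>2"
        using near[OF k(1) k(1), of i j] k(2)[of i] k(2)[of j] N[OF \<open>i \<ge> N\<close>] N[OF \<open>j \<ge> N\<close>]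
        by argo
      then show "dist (fst (k i)) (fst (k j)) < e"
        using \<open>e > 0\<close> by (simp add: power_less_imp_less_base)
    qed
  qed
  then obtain p where p: "(\<lambda>n. fst (k n)) \<longlonglongrightarrow> p"
    using Cauchy_convergent convergent_def by blast
  \<comment> \<open>This is the value for which \<open>\<phi> (p, s) = m\<close>; the second
    components converge to it because \<phi> and the first components converge.\<close>
  define s where "s = m - (norm p)\<^sup>2 / 2"
  have \<phi>m: "(\<lambda>n. \<phi> (k n)) \<longlonglongrightarrow> m"
  proof (rule tendsto_sandwich[where f = "\<lambda>_. m"])
    show "(\<lambda>n. m + 1 / Suc n) \<longlonglongrightarrow> m"
      using tendsto_add[OF tendsto_const lim0, of m] by simp
  qed (use k m_le in \<open>auto intro!: always_eventually less_imp_le simp del: of_nat_Suc\<close>)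
  have "(\<lambda>n. \<phi> (k n) - (norm (fst (k n)))\<^sup>2 / 2) \<longlonglongrightarrow> s"
    unfolding s_def by (intro tendsto_intros \<phi>m p) auto
  then have "(\<lambda>n. (fst (k n), snd (k n))) \<longlonglongrightarrow> (p, s)"
    by (intro tendsto_Pair p) (simp add: \<phi>_def)
  then have "k \<longlonglongrightarrow> (p, s)"
    unfolding prod.collapse .
  with \<open>closed K\<close> k(1) have ps: "(p, s) \<in> K"
    by (rule closed_sequentially)
  show thesis
  proof (rule that[OF ps])
    fix w r assume w: "(w, r) \<in> K"
    \<comment> \<open>First-order optimality: \<phi> is compared at \<open>(p, s)\<close> and at a
      point of the segment towards \<open>(w, r)\<close>. The factor \<open>t\<close> is divided
      out, and afterwards \<open>t\<close> tends to 0 from the right.\<close>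
    have "0 \<le> r - s + inner p (w - p) + t * ((norm (w - p))\<^sup>2 / 2)" if "0 < t" "t \<le> 1" for t
    proof -
      have "(1 - t) *\<^sub>R (p, s) + t *\<^sub>R (w, r) \<in> K"
        using that by (intro convexD[OF \<open>convex K\<close> ps w]) auto
      then have "m \<le> \<phi> ((1 - t) *\<^sub>R (p, s) + t *\<^sub>R (w, r))"
        by (rule m_le)
      also have "\<dots> = m + t * (r - s + inner p (w - p) + t * ((norm (w - p))\<^sup>2 / 2))"
        by (simp add: \<phi>_def s_def power2_norm_eq_inner inner_simps inner_commute field_simps)
      finally show ?thesis using \<open>0 < t\<close> by (simp add: zero_le_mult_iff)
    qed
    then have "eventually (\<lambda>t. 0 \<le> r - s + inner p (w - p) + t * ((norm (w - p))\<^sup>2 / 2)) (at_right 0)"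
      by (auto simp: eventually_at_right_field intro!: exI[of _ 1])
    moreover have "((\<lambda>t. r - s + inner p (w - p) + t * ((norm (w - p))\<^sup>2 / 2)) \<longlongrightarrow>
        r - s + inner p (w - p) + 0 * ((norm (w - p))\<^sup>2 / 2)) (at_right 0)"
      by (intro tendsto_intros)
    ultimately have "0 \<le> r - s + inner p (w - p) + 0 * ((norm (w - p))\<^sup>2 / 2)"
      by (intro tendsto_lowerbound) auto
    then show "s - inner p (w - p) \<le> r" by simp
  qed
qed

text \<open>Minimising over the epigraph of \<open>f\<close> yields \<open>p\<close> with
  \<open>0 \<le> f y + inner p y\<close> for every \<open>y\<close>. Replacing \<open>y\<close> by
  \<open>- y\<close> turns this into an equality, so \<open>- p\<close> represents
  \<open>f\<close>.\<close>

lemma riesz_representation: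
  fixes f :: "'a::{real_inner,complete_space} \<Rightarrow> real"
  assumes "bounded_linear f"
  obtains a where "\<And>y. f y = inner a y"
proof -
  interpret f: bounded_linear f by fact
  obtain B where B: "\<And>x. norm (f x) \<le> norm x * B"
    using f.bounded by blast
  define K where "K = {k. f (fst k) \<le> snd k}"
  have convex: "convex K"
    unfolding convex_def K_def
    by (auto simp: f.add f.scaleR intro!: add_mono mult_left_mono)
  have closed: "closed K"
    unfolding K_def
    by (intro closed_Collect_le continuous_intros continuous_on_compose2[OF linear_continuous_on[OF assms, of UNIV]]) auto
  have nonempty: "K \<noteq> {}"
    using f.zero by (auto simp: K_def intro!: exI[of _ 0])
  \<comment> \<open>Completing the square in \<open>norm w\<close> after bounding \<open>f w\<close>
    below by \<open>- (norm w * B)\<close>.\<close>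
  have bound: "- B\<^sup>2 / 2 \<le> r + (norm w)\<^sup>2 / 2" if "(w, r) \<in> K" for w r
  proof -
    have "- (norm w * B) \<le> r" using that B[of w] by (simp add: K_def abs_le_iff)
    moreover have "0 \<le> (norm w - B)\<^sup>2" by simp
    ultimately show ?thesis by (simp add: power2_eq_square algebra_simps)
  qed
  obtain p s where ps: "f p \<le> s" and min: "\<And>w r. f w \<le> r \<Longrightarrow> s - inner p (w - p) \<le> r"
    using quadratic_minimizer[OF convex closed nonempty bound] by (auto simp: K_def)
  have ge: "0 \<le> f y + inner p y" for y
    using min[of "p + y" "f (p + y)"] ps by (simp add: f.add)
  have "f y = inner (- p) y" for y
    using ge[of y] ge[of "- y"] by (simp add: f.neg)
  then show thesis by (rule that)
qed

text \<open>\<open>K\<close> is the epigraph of the Fitzpatrick function of \<open>G\<close>.\<close>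

lemma minty_graph:
  fixes G :: "('a::{real_inner,complete_space} \<times> 'a) set"
  assumes mono: "\<And>x a y b. (x, a) \<in> G \<Longrightarrow> (y, b) \<in> G \<Longrightarrow> 0 \<le> inner (a - b) (x - y)"
    and maximal: "\<And>x a. (\<And>y b. (y, b) \<in> G \<Longrightarrow> 0 \<le> inner (a - b) (x - y)) \<Longrightarrow> (x, a) \<in> G"
  obtains x where "(x, - x) \<in> G"
proof -
  define K where "K = (\<Inter>(y, b)\<in>G. {k :: ('a \<times> 'a) \<times> real. inner (b, y) (fst k) - inner y b \<le> snd k})"
  have convex: "convex K"
    unfolding K_def
  proof (intro convex_INT, clarify)
    fix y b
    show "convex {k :: ('a \<times> 'a) \<times> real. inner (b, y) (fst k) - inner y b \<le> snd k}"
    proof (rule convexI, clarsimp)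
      fix x1 x2 x3 z1 z2 z3 u v
      assume a: "inner b x1 + inner y x2 - inner y b \<le> x3" "inner b z1 + inner y z2 - inner y b \<le> z3"
        "0 \<le> u" "0 \<le> v" "u + v = (1::real)"
      have "u * (inner b x1 + inner y x2 - inner y b) + v * (inner b z1 + inner y z2 - inner y b) \<le> u * x3 + v * z3"
        using a by (intro add_mono mult_left_mono) auto
      moreover have "inner y b = u * inner y b + v * inner y b"
        using a by (simp add: distrib_right[symmetric])
      ultimately show "inner b (u *\<^sub>R x1 + v *\<^sub>R z1) + inner y (u *\<^sub>R x2 + v *\<^sub>R z2) - inner y b \<le> u * x3 + v * z3"
        by (simp add: inner_simps algebra_simps)
    qed
  qed
  have closed: "closed K"
    unfolding K_def by (intro closed_INT ballI) (auto simp: split_beta intro!: closed_Collect_le continuous_intros)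
  have fitz_graph: "((x, a), inner x a) \<in> K" if "(x, a) \<in> G" for x a
    using mono[OF that] by (auto simp: K_def inner_simps inner_commute algebra_simps)
  \<comment> \<open>Off the graph, maximality supplies a pair \<open>(y, b)\<close> that is not
    monotonically related to \<open>(x, a)\<close>; its constraint in \<open>K\<close> already
    forces \<open>r\<close> above the pairing.\<close>
  have fitz_ge: "inner x a \<le> r" if k: "((x, a), r) \<in> K" for x a r
  proof (cases "(x, a) \<in> G")
    case True
    then show ?thesis using k by (auto simp: K_def inner_simps inner_commute)
  next
    case False
    then obtain y b where "(y, b) \<in> G" "inner (a - b) (x - y) < 0"
      using maximal by (meson not_le)
    then show ?thesis using k by (force simp: K_def inner_simps inner_commute algebra_simps)
  qed
  have bound: "0 \<le> r + (norm w)\<^sup>2 / 2" if wr: "(w, r) \<in> K" for w r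
  proof -
    obtain x a where w: "w = (x, a)" by (cases w)
    have "0 \<le> (norm (x + a))\<^sup>2 / 2" by simp
    also have "\<dots> \<le> r + (norm w)\<^sup>2 / 2"
      using fitz_ge[of x a r] wr
      by (simp add: w power2_norm_eq_inner inner_simps inner_commute field_simps)
    finally show ?thesis .
  qed
  have nonempty: "K \<noteq> {}"
  proof -
    have "G \<noteq> {}" using maximal by blast
    then show ?thesis using fitz_graph by fast
  qed
  obtain w s where ws: "(w, s) \<in> K"
      and min: "\<And>v r. (v, r) \<in> K \<Longrightarrow> s - inner w (v - w) \<le> r"
    using quadratic_minimizer[OF convex closed nonempty bound] by metis
  obtain p q where w: "w = (p, q)" by (cases w)
  \<comment> \<open>The optimality condition is tested at a point of the graph, where the pairing
    belongs to the epigraph, and combined with \<open>inner p q \<le> s\<close>. The components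
    change roles: it is \<open>(- q, - p)\<close> that turns out to be related to all of
    \<open>G\<close>.\<close>
  have key: "(norm (p + q))\<^sup>2 \<le> inner (- p - b) (- q - y)" if "(y, b) \<in> G" for y b
    using min[OF fitz_graph[OF that]] fitz_ge[of p q s] ws
    by (simp add: w power2_norm_eq_inner inner_simps inner_commute)
  then have mem: "(- q, - p) \<in> G"
    by (intro maximal) (meson order_trans zero_le_power2)
  \<comment> \<open>Testing at \<open>(- q, - p)\<close> itself makes the right-hand side vanish,
    which leaves the point \<open>(p, - p)\<close> of the graph.\<close>
  have "(norm (p + q))\<^sup>2 \<le> 0"
    using key[OF mem] by simp
  then have "q = - p"
    by (simp add: add_eq_0_iff)
  with mem show thesis by (auto intro: that)
qed

section \<open>The Yosida approximation\<close>

text \<open>Adjoining the pair \<open>(x, a)\<close> to the graph keeps it monotone, so by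
  maximality it was there already.\<close>

lemma maximal_monotone_memI:
  assumes A: "maximal_monotone A" and "\<And>y b. b \<in> A y \<Longrightarrow> 0 \<le> inner (a - b) (x - y)"
  shows "a \<in> A x"
proof -
  define B where "B = A(x := insert a (A x))"
  have sym: "inner (b - a) (y - x) = inner (a - b) (x - y)" for y b
    by (simp add: inner_simps)
  have "monotone_operator A"
    using A by (simp add: maximal_monotone_def)
  then have "monotone_operator B"
    using assms(2) by (auto simp: monotone_operator_def B_def sym)
  moreover have "\<forall>y. A y \<subseteq> B y"
    by (auto simp: B_def)
  ultimately have "B = A"
    using A by (auto simp: maximal_monotone_def)
  then show ?thesis
    by (metis B_def fun_upd_same insertI1)
qed

lemma mem_resolvent_set_iff: "y \<in> resolvent_set l A x \<longleftrightarrow> (\<exists>a\<in>A y. x = y + l *\<^sub>R a)"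
  by (auto simp: resolvent_set_def operator_inverse_def)

text \<open>The graph \<open>G\<close> of \<open>y \<mapsto> l A y - x\<close> inherits monotonicity
  and maximality from \<open>A\<close>, and a point \<open>(y, - y)\<close> of it says exactly that
  \<open>x \<in> y + l A y\<close>.\<close>

lemma resolvent_set_nonempty:
  fixes A :: "'h::{real_inner,complete_space} \<Rightarrow> 'h set"
  assumes A: "maximal_monotone A" and "l > 0"
  shows "resolvent_set l A x \<noteq> {}"
proof -
  define G where "G = {(y, l *\<^sub>R a - x) | y a. a \<in> A y}"
  have "0 \<le> inner (a - b) (y - z)" if mem: "(y, a) \<in> G" "(z, b) \<in> G" for y a z b
  proof -
    obtain a' b' where ab: "a' \<in> A y" "b' \<in> A z" "a = l *\<^sub>R a' - x" "b = l *\<^sub>R b' - x"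
      using mem by (auto simp: G_def)
    then have "a - b = l *\<^sub>R (a' - b')"
      by (simp add: scaleR_diff_right)
    then have "inner (a - b) (y - z) = l * inner (a' - b') (y - z)"
      by simp
    with ab show ?thesis
      using A \<open>l > 0\<close> by (simp add: maximal_monotone_def monotone_operator_def)
  qed
  moreover have "(y, c) \<in> G" if rel: "\<And>z b. (z, b) \<in> G \<Longrightarrow> 0 \<le> inner (c - b) (y - z)" for y c
  proof -
    have "(1 / l) *\<^sub>R (c + x) \<in> A y"
    proof (rule maximal_monotone_memI[OF A])
      fix z b assume "b \<in> A z"
      then have "0 \<le> inner (c - (l *\<^sub>R b - x)) (y - z)"
        by (intro rel) (auto simp: G_def)
      also have "\<dots> = l * inner ((1 / l) *\<^sub>R (c + x) - b) (y - z)"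
        using \<open>l > 0\<close> by (simp add: inner_simps field_simps)
      finally show "0 \<le> inner ((1 / l) *\<^sub>R (c + x) - b) (y - z)"
        using \<open>l > 0\<close> by (simp add: zero_le_mult_iff)
    qed
    moreover have "c = l *\<^sub>R ((1 / l) *\<^sub>R (c + x)) - x"
      using \<open>l > 0\<close> by simp
    ultimately show ?thesis
      unfolding G_def by blast
  qed
  ultimately obtain y where "(y, - y) \<in> G"
    using minty_graph[of G] by metis
  then obtain a where "a \<in> A y" "- y = l *\<^sub>R a - x"
    by (auto simp: G_def)
  then have "y \<in> resolvent_set l A x"
    by (auto simp: mem_resolvent_set_iff algebra_simps intro!: bexI[of _ a])
  then show ?thesis by blast
qed

lemma resolvent_set_unique:
  assumes "monotone_operator A" "l > 0" "y \<in> resolvent_set l A x" "z \<in> resolvent_set l A x"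
  shows "y = z"
proof -
  obtain a b where ab: "a \<in> A y" "b \<in> A z" "x = y + l *\<^sub>R a" "x = z + l *\<^sub>R b"
    using assms by (auto simp: mem_resolvent_set_iff)
  have "y - z = - (l *\<^sub>R (a - b))"
    using ab(3,4) by (simp add: algebra_simps)
  then have "inner (y - z) (y - z) = - (l * inner (a - b) (y - z))"
    by (metis inner_minus_left inner_scaleR_left)
  moreover have "0 \<le> inner (a - b) (y - z)"
    using assms(1) ab by (simp add: monotone_operator_def)
  ultimately have "inner (y - z) (y - z) \<le> 0"
    using \<open>l > 0\<close> by simp
  then show ?thesis
    by (metis eq_iff_diff_eq_0 inner_eq_zero_iff inner_ge_zero order_antisym)
qed

context
  fixes A :: "'h::{real_inner,complete_space} \<Rightarrow> 'h set" and l :: real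
  assumes A: "maximal_monotone A" and l: "l > 0"
begin

text \<open>This inclusion is \<open>A\<^sub>l x \<in> A (J x)\<close> with the resolvent point
  written as \<open>x - l A\<^sub>l x\<close>. All further properties of the Yosida approximation
  are drawn from it, without returning to the resolvent.\<close>

lemma yosida_mem: "yosida l A x \<in> A (x - l *\<^sub>R yosida l A x)"
proof -
  have "\<exists>!y. y \<in> resolvent_set l A x"
    using resolvent_set_nonempty[OF A l] resolvent_set_unique[OF _ l, of A] A
    by (metis ex_in_conv maximal_monotone_def)
  then have "resolvent l A x \<in> resolvent_set l A x"
    unfolding resolvent_def by (rule theI')
  then obtain a where "a \<in> A (resolvent l A x)" "x = resolvent l A x + l *\<^sub>R a"
    by (auto simp: mem_resolvent_set_iff)
  moreover from this have "yosida l A x = a"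
    using l by (metis add_diff_cancel_left' less_irrefl nonzero_divide_eq_eq scaleR_one scaleR_scaleR yosida_def)
  ultimately show ?thesis
    by (metis add_diff_cancel_right')
qed

text \<open>Monotonicity of \<open>A\<close> at the two resolvent points; the corrections
  \<open>l A\<^sub>l x\<close> and \<open>l A\<^sub>l y\<close> produce the quadratic term.\<close>

lemma yosida_cocoercive:
  "l * (norm (yosida l A x - yosida l A y))\<^sup>2 \<le> inner (yosida l A x - yosida l A y) (x - y)"
proof -
  define a b where "a = yosida l A x" and "b = yosida l A y"
  have "0 \<le> inner (a - b) ((x - l *\<^sub>R a) - (y - l *\<^sub>R b))"
    using A yosida_mem[of x] yosida_mem[of y]
    unfolding a_def b_def maximal_monotone_def monotone_operator_def by blast
  also have "\<dots> = inner (a - b) (x - y) - l * (norm (a - b))\<^sup>2"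
    by (simp add: power2_norm_eq_inner inner_simps inner_commute algebra_simps)
  finally show ?thesis by (simp add: a_def b_def)
qed

lemma yosida_lipschitz: "norm (yosida l A x - yosida l A y) \<le> norm (x - y) / l"
proof -
  define d where "d = norm (yosida l A x - yosida l A y)"
  have "l * d\<^sup>2 \<le> d * norm (x - y)"
    unfolding d_def by (meson yosida_cocoercive norm_cauchy_schwarz order_trans)
  then have "d * (l * d) \<le> d * norm (x - y)"
    by (simp add: power2_eq_square algebra_simps)
  then have "d = 0 \<or> l * d \<le> norm (x - y)"
    using mult_le_cancel_left_pos[of d] norm_ge_zero unfolding d_def by fastforce
  then show ?thesis
    using l unfolding d_def[symmetric] by (auto simp: field_simps)
qed

text \<open>Monotonicity between the pair of \<open>yosida_mem\<close> and the pair
  \<open>(z, 0)\<close> gives \<open>- l \<bar>A\<^sub>l z\<bar>\<^sup>2 \<ge> 0\<close>.\<close>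

lemma yosida_zero:
  assumes "0 \<in> A z"
  shows "yosida l A z = 0"
proof -
  have "0 \<le> inner (yosida l A z - 0) ((z - l *\<^sub>R yosida l A z) - z)"
    using A yosida_mem[of z] assms unfolding maximal_monotone_def monotone_operator_def by blast
  then have "l * inner (yosida l A z) (yosida l A z) \<le> 0"
    by simp
  then have "inner (yosida l A z) (yosida l A z) \<le> 0"
    using l by (simp add: mult_le_0_iff)
  then show ?thesis
    by (metis inner_eq_zero_iff inner_ge_zero order_antisym)
qed

end

section \<open>Ordinary differential equations on the half line\<close>

lemma has_vector_derivative_halfline_imp_at:
  fixes f :: "real \<Rightarrow> 'a::real_normed_vector"
  assumes "(f has_vector_derivative f') (at t within {0..})" "t > 0"
  shows "(f has_vector_derivative f') (at t)"
  using assms at_within_interior[of t "{0..}"] by simp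

lemma halfline_deriv_nonpos_imp_le:
  fixes h :: "real \<Rightarrow> real"
  assumes deriv: "\<And>t. t \<ge> 0 \<Longrightarrow> (h has_real_derivative h' t) (at t within {0..})"
    and "\<And>t. t \<ge> 0 \<Longrightarrow> h' t \<le> 0" "0 \<le> s" "s \<le> t"
  shows "h t \<le> h s"
proof (rule DERIV_nonpos_imp_decreasing_open[OF \<open>s \<le> t\<close>])
  show "\<exists>y. (h has_real_derivative y) (at x) \<and> y \<le> 0" if "s < x" "x < t" for x
    using deriv[of x] assms that at_within_interior[of x "{0..}"] by auto
  have "continuous_on {0..} h"
    using deriv by (metis DERIV_continuous_on atLeast_iff)
  then show "continuous_on {s..t} h"
    by (rule continuous_on_subset) (use \<open>0 \<le> s\<close> in auto)
qed

lemma halfline_mean_value_bound: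
  fixes f :: "real \<Rightarrow> 'a::real_normed_vector"
  assumes f: "\<And>r. r \<ge> 0 \<Longrightarrow> (f has_vector_derivative f' r) (at r within {0..})"
    and bound: "\<And>r. s < r \<Longrightarrow> r < t \<Longrightarrow> norm (f' r) \<le> B" and "0 \<le> s" "s \<le> t"
  shows "norm (f t - f s) \<le> B * (t - s)"
proof (cases "s = t")
  case False
  have "norm (f t - f s) \<le> B * t - B * s"
  proof (rule differentiable_bound_general[where f' = f' and \<phi>' = "\<lambda>_. B"])
    have "continuous_on {0..} f"
      using f by (meson atLeast_iff continuous_on_eq_continuous_within has_vector_derivative_continuous)
    then show "continuous_on {s..t} f"
      by (rule continuous_on_subset) (use \<open>0 \<le> s\<close> in auto)
    show "(f has_vector_derivative f' r) (at r)" if "s < r" "r < t" for r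
      using f[of r] that \<open>0 \<le> s\<close> by (auto intro: has_vector_derivative_halfline_imp_at)
    show "((\<lambda>r. B * r) has_vector_derivative B) (at r)" for r
      unfolding has_real_derivative_iff_has_vector_derivative[symmetric]
      by (auto intro!: derivative_eq_intros)
    show "continuous_on {s..t} (\<lambda>r. B * r)"
      by (intro continuous_intros)
  qed (use bound False \<open>s \<le> t\<close> in auto)
  then show ?thesis by (simp add: algebra_simps)
qed simp

text \<open>A type of sort \<open>{real_inner, complete_space}\<close> is not of class \<open>banach\<close>, so the library's
  vector-valued integral does not apply; the antiderivative is obtained weakly from real integrals.\<close>

lemma antiderivative_halfline:
  fixes g :: "real \<Rightarrow> 'a::{real_inner,complete_space}"
  assumes cont: "continuous_on {0..} g"
  obtains F where "F 0 = 0" "\<And>t. t \<ge> 0 \<Longrightarrow> (F has_vector_derivative g t) (at t within {0..})"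
proof -
  have cont_inner: "continuous_on {0..t} (\<lambda>s. inner (g s) y)" for t y
    by (intro continuous_intros continuous_on_subset[OF cont]) auto
  have "\<exists>a. \<forall>y. integral {0..t} (\<lambda>s. inner (g s) y) = inner a y" for t
  proof -
    have int: "(\<lambda>s. inner (g s) y) integrable_on {0..t}" for y
      by (intro integrable_continuous_real cont_inner)
    have "bounded (g ` {0..t})"
      by (intro compact_imp_bounded compact_continuous_image continuous_on_subset[OF cont]) auto
    then obtain B where B: "\<And>s. s \<in> {0..t} \<Longrightarrow> norm (g s) \<le> B"
      by (force simp: bounded_iff)
    have "bounded_linear (\<lambda>y. integral {0..t} (\<lambda>s. inner (g s) y))"
    proof (rule bounded_linear_intro[where K = "integral {0..t} (\<lambda>_. B)"])
      fix y
      have "norm (integral {0..t} (\<lambda>s. inner (g s) y)) \<le> integral {0..t} (\<lambda>_. norm y * B)"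
      proof (rule integral_norm_bound_integral[OF int])
        fix s assume "s \<in> {0..t}"
        then have "norm (g s) * norm y \<le> B * norm y"
          by (intro mult_right_mono B) auto
        then show "norm (inner (g s) y) \<le> norm y * B"
          using Cauchy_Schwarz_ineq2[of "g s" y] by (simp add: mult.commute)
      qed auto
      then show "norm (integral {0..t} (\<lambda>s. inner (g s) y)) \<le> norm y * integral {0..t} (\<lambda>_. B)"
        by (cases "0 \<le> t") (simp_all add: mult_ac)
    qed (use int in \<open>simp_all add: inner_add_right integral_add\<close>)
    then obtain a where "\<And>y. integral {0..t} (\<lambda>s. inner (g s) y) = inner a y"
      by (rule riesz_representation) (rule that)
    then show ?thesis by blast
  qed
  then obtain F where F: "\<And>t y. inner (F t) y = integral {0..t} (\<lambda>s. inner (g s) y)"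
    by metis
  have F0: "F 0 = 0"
    using F[of 0 "F 0"] by simp
  have scalar: "((\<lambda>t. inner (F t) y) has_real_derivative inner (g t) y) (at t within {0..})" if "t \<ge> 0" for t y
  proof -
    have "((\<lambda>t. inner (F t) y) has_real_derivative inner (g t) y) (at t within {0..t + 1})"
      unfolding F by (rule integral_has_real_derivative[OF cont_inner]) (use that in auto)
    \<comment> \<open>The upper end \<open>t + 1\<close> leaves room to the right of
      \<open>t\<close>, so both filters agree near \<open>t\<close>.\<close>
    moreover have "at t within {0..t + 1} = at t within {0..}"
      by (rule at_within_nhd[of _ "{..<t + 1}"]) auto
    ultimately show ?thesis by simp
  qed
  have "(F has_vector_derivative g t) (at t within {0..})" if t: "t \<ge> 0" for t
    unfolding has_vector_derivative_def has_derivative_within_alt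
  proof (intro conjI allI impI bounded_linear_scaleR_left)
    fix e :: real assume "e > 0"
    then obtain d where d: "d > 0" "\<And>s. s \<ge> 0 \<Longrightarrow> dist s t < d \<Longrightarrow> dist (g s) (g t) < e"
      using cont t unfolding continuous_on_iff by (metis atLeast_iff)
    have "norm (F s - F t - (s - t) *\<^sub>R g t) \<le> e * norm (s - t)" if s: "s \<in> {0..}" "norm (s - t) < d" for s
    proof -
      \<comment> \<open>The remainder itself serves as the test direction. The scalar estimate is
        uniform in the direction, so it bounds \<open>\<bar>y\<bar>\<^sup>2\<close> by
        \<open>e \<bar>s - t\<bar> \<bar>y\<bar>\<close>; this upgrades weak differentiability to
        strong.\<close>
      define y where "y = F s - F t - (s - t) *\<^sub>R g t"
      let ?S = "ball t d \<inter> {0..}"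
      have "norm ((inner (F s) y - s * inner (g t) y) - (inner (F t) y - t * inner (g t) y)) \<le> (e * norm y) * norm (s - t)"
      proof (rule field_differentiable_bound)
        show "convex ?S" by (intro convex_Int) auto
        show "((\<lambda>r. inner (F r) y - r * inner (g t) y) has_real_derivative inner (g r) y - inner (g t) y) (at r within ?S)"
          if "r \<in> ?S" for r
          using that by (auto intro!: derivative_eq_intros DERIV_subset[OF scalar])
        show "norm (inner (g r) y - inner (g t) y) \<le> e * norm y" if "r \<in> ?S" for r
        proof -
          have "norm (inner (g r) y - inner (g t) y) \<le> norm (g r - g t) * norm y"
            by (metis Cauchy_Schwarz_ineq2 inner_diff_left real_norm_def)
          also have "\<dots> \<le> e * norm y"
            using d(2)[of r] that by (intro mult_right_mono) (auto simp: dist_norm norm_minus_commute abs_minus_commute less_imp_le)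
          finally show ?thesis .
        qed
      qed (use s \<open>t \<ge> 0\<close> d in \<open>auto simp: dist_norm norm_minus_commute\<close>)
      moreover have "(inner (F s) y - s * inner (g t) y) - (inner (F t) y - t * inner (g t) y) = inner y y"
        unfolding y_def by (simp add: inner_simps algebra_simps)
      ultimately have "norm y * norm y \<le> norm y * (e * norm (s - t))"
        by (simp add: power2_norm_eq_inner[symmetric] power2_eq_square algebra_simps)
      moreover have "0 \<le> e * norm (s - t)" using \<open>e > 0\<close> by simp
      ultimately have "norm y \<le> e * norm (s - t)"
        by (metis mult_le_cancel_left_pos norm_ge_zero order_le_less)
      then show ?thesis by (simp add: y_def)
    qed
    then show "\<exists>d>0. \<forall>s\<in>{0..}. norm (s - t) < d \<longrightarrow> norm (F s - F t - (s - t) *\<^sub>R g t) \<le> e * norm (s - t)"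
      using d(1) by blast
  qed
  with F0 show thesis by (rule that)
qed

text \<open>Comparison with the primitive \<open>C / k * exp (k * s)\<close> of the bound.
  Integration gains a factor \<open>1 / k\<close> while the exponential weight is preserved, which
  is the source of the contraction below.\<close>

lemma norm_antiderivative_exp_bound:
  fixes F :: "real \<Rightarrow> 'a::real_normed_vector"
  assumes F: "\<And>s. s \<ge> 0 \<Longrightarrow> (F has_vector_derivative g s) (at s within {0..})"
    and g: "\<And>s. s \<ge> 0 \<Longrightarrow> norm (g s) \<le> C * exp (k * s)" and "k > 0" "t \<ge> 0"
  shows "norm (F t - F 0) \<le> C / k * (exp (k * t) - 1)"
proof (cases "t = 0")
  case False
  have "norm (F t - F 0) \<le> C / k * exp (k * t) - C / k * exp (k * 0)"
  proof (rule differentiable_bound_general[where f' = g and \<phi>' = "\<lambda>s. C * exp (k * s)"])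
    show "continuous_on {0..t} F"
      by (meson F atLeastAtMost_iff atLeast_iff continuous_on_eq_continuous_within continuous_within_subset
          has_vector_derivative_continuous subsetI)
    show "(F has_vector_derivative g s) (at s)" if "0 < s" "s < t" for s
      using F[of s] that by (auto intro: has_vector_derivative_halfline_imp_at)
    show "((\<lambda>s. C / k * exp (k * s)) has_vector_derivative C * exp (k * s)) (at s)" for s
      unfolding has_real_derivative_iff_has_vector_derivative[symmetric]
      using \<open>k > 0\<close> by (auto intro!: derivative_eq_intros)
    show "continuous_on {0..t} (\<lambda>s. C / k * exp (k * s))"
      by (intro continuous_intros)
  qed (use g \<open>t \<ge> 0\<close> False in auto)
  then show ?thesis by (simp add: algebra_simps)
qed (use assms in auto)

text \<open>With the weight \<open>exp (- 2 L t)\<close> (Bielecki's norm) the Picard operator is a contraction on the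
  whole half line at once.\<close>

lemma global_lipschitz_ode_exists:
  fixes f :: "'a::{real_inner,complete_space} \<Rightarrow> 'a"
  assumes lip: "\<And>x y. norm (f x - f y) \<le> L * norm (x - y)" and "L > 0"
  obtains X where "X 0 = x0" "\<And>t. t \<ge> 0 \<Longrightarrow> (X has_vector_derivative f (X t)) (at t within {0..})"
proof -
  \<comment> \<open>The contraction constant will be \<open>L / k = 1/2\<close>.\<close>
  define k where "k = 2 * L"
  have k: "k > 0" using \<open>L > 0\<close> by (simp add: k_def)
  have contf: "continuous_on UNIV f"
    using lip \<open>L > 0\<close> by (intro lipschitz_on_continuous_on[of L] lipschitz_onI) (auto simp: dist_norm)
  define v :: "(real \<Rightarrow>\<^sub>C 'a) \<Rightarrow> real \<Rightarrow> 'a" where "v w s = exp (k * s) *\<^sub>R apply_bcontfun w s" for w s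
  have "\<exists>F. F 0 = 0 \<and> (\<forall>t\<ge>0. (F has_vector_derivative f (v w t)) (at t within {0..}))" for w
  proof -
    have "continuous_on {0..} (\<lambda>t. f (v w t))"
      unfolding v_def by (intro continuous_intros continuous_on_compose2[OF contf]) auto
    then obtain F where "F 0 = 0" "\<And>t. t \<ge> 0 \<Longrightarrow> (F has_vector_derivative f (v w t)) (at t within {0..})"
      by (rule antiderivative_halfline) (rule that)
    then show ?thesis by blast
  qed
  then obtain I where I0: "\<And>w. I w 0 = 0"
      and I: "\<And>w t. t \<ge> 0 \<Longrightarrow> (I w has_vector_derivative f (v w t)) (at t within {0..})"
    by metis
  \<comment> \<open>Bounded continuous functions live on the whole real line, so
    \<open>max t 0\<close> freezes negative times at the initial value. The fixed point
    \<open>w\<close> is the solution divided by \<open>exp (k * t)\<close>.\<close>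
  define T where "T w t = exp (- k * max t 0) *\<^sub>R (x0 + I w (max t 0))" for w t
  have T: "T w \<in> bcontfun" for w
  proof (rule bcontfun_normI)
    have "continuous_on {0..} (I w)"
      using I by (meson atLeast_iff continuous_on_eq_continuous_within has_vector_derivative_continuous)
    then have "continuous_on UNIV (\<lambda>t. I w (max t 0))"
      by (rule continuous_on_compose2) (auto intro!: continuous_intros)
    then show "continuous_on UNIV (T w)"
      unfolding T_def by (intro continuous_intros)
    fix t :: real
    define s where "s = max t 0"
    have "s \<ge> 0" by (simp add: s_def)
    \<comment> \<open>Linear growth of \<open>f\<close> combined with
      \<open>1 \<le> exp (k * r)\<close>.\<close>
    define C where "C = norm (f 0) + L * norm w"
    have "norm (f (v w r)) \<le> C * exp (k * r)" if "r \<ge> 0" for r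
    proof -
      have "norm (f (v w r)) \<le> norm (f 0) + L * norm (v w r)"
        using lip[of "v w r" 0] norm_triangle_sub[of "f (v w r)" "f 0"] by simp
      also have "\<dots> \<le> exp (k * r) * norm (f 0) + L * (exp (k * r) * norm w)"
        using \<open>L > 0\<close> k that norm_bounded[of w r] unfolding v_def
        by (intro add_mono mult_left_mono) (auto simp: mult_le_cancel_right1)
      finally show ?thesis by (simp add: C_def algebra_simps)
    qed
    then have "norm (I w s) \<le> C / k * (exp (k * s) - 1)"
      using norm_antiderivative_exp_bound[OF I _ k \<open>s \<ge> 0\<close>] I0 by fastforce
    also have "\<dots> \<le> C / k * exp (k * s)"
      using k \<open>L > 0\<close> by (intro mult_left_mono) (auto simp: C_def)
    finally have "exp (- k * s) * norm (x0 + I w s) \<le> exp (- k * s) * (exp (k * s) * norm x0 + C / k * exp (k * s))"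
      using k \<open>s \<ge> 0\<close> by (intro mult_left_mono norm_triangle_le add_mono) (auto simp: mult_le_cancel_right1)
    also have "\<dots> = norm x0 + C / k"
      by (simp add: exp_minus field_simps)
    finally show "norm (T w t) \<le> norm x0 + C / k"
      by (simp add: T_def s_def)
  qed
  have "\<exists>!w. Bcontfun (T w) = w"
  proof -
    have "dist (Bcontfun (T w)) (Bcontfun (T w')) \<le> 1/2 * dist w w'" for w w'
    proof (rule dist_bound)
      fix t :: real
      define s where "s = max t 0"
      have "s \<ge> 0" by (simp add: s_def)
      have "((\<lambda>r. I w r - I w' r) has_vector_derivative f (v w r) - f (v w' r)) (at r within {0..})" if "r \<ge> 0" for r
        using that by (intro derivative_intros I)
      moreover have "norm (f (v w r) - f (v w' r)) \<le> (L * dist w w') * exp (k * r)" for r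
      proof -
        have "norm (f (v w r) - f (v w' r)) \<le> L * (exp (k * r) * dist (apply_bcontfun w r) (apply_bcontfun w' r))"
          using lip[of "v w r" "v w' r"] by (simp add: v_def dist_norm flip: scaleR_diff_right)
        also have "\<dots> \<le> L * (exp (k * r) * dist w w')"
          using \<open>L > 0\<close> by (intro mult_left_mono dist_bounded) auto
        finally show ?thesis by (simp add: algebra_simps)
      qed
      ultimately have "norm ((I w s - I w' s) - (I w 0 - I w' 0)) \<le> (L * dist w w') / k * (exp (k * s) - 1)"
        using k \<open>s \<ge> 0\<close> by (intro norm_antiderivative_exp_bound) auto
      also have "\<dots> \<le> 1/2 * dist w w' * exp (k * s)"
        using \<open>L > 0\<close> by (simp add: k_def algebra_simps)
      finally have "exp (- k * s) * norm (I w s - I w' s) \<le> exp (- k * s) * (1/2 * dist w w' * exp (k * s))"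
        by (intro mult_left_mono) (auto simp: I0)
      also have "\<dots> = 1/2 * dist w w'"
        by (simp add: exp_minus field_simps)
      finally show "dist (apply_bcontfun (Bcontfun (T w)) t) (apply_bcontfun (Bcontfun (T w')) t) \<le> 1/2 * dist w w'"
        by (simp add: Bcontfun_inverse T T_def s_def dist_norm flip: scaleR_diff_right)
    qed
    then show ?thesis
      by (intro banach_fix_type[of "1/2"]) auto
  qed
  then obtain w where "Bcontfun (T w) = w" by blast
  then have w: "apply_bcontfun w t = T w t" for t
    by (metis Bcontfun_inverse T)
  have v: "v w t = x0 + I w t" if "t \<ge> 0" for t
    using that by (simp add: v_def w T_def flip: exp_add)
  show thesis
  proof (rule that)
    show "x0 + I w 0 = x0" by (simp add: I0)
    fix t :: real assume "t \<ge> 0"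
    then show "((\<lambda>t. x0 + I w t) has_vector_derivative f (x0 + I w t)) (at t within {0..})"
      using I[of t w] v[of t] by (auto intro!: derivative_eq_intros)
  qed
qed

lemma has_real_derivative_norm_square:
  fixes X :: "real \<Rightarrow> 'a::real_inner"
  assumes "(X has_vector_derivative X') (at t within S)"
  shows "((\<lambda>t. (norm (X t))\<^sup>2) has_real_derivative 2 * inner (X t) X') (at t within S)"
  unfolding power2_norm_eq_inner
  using bounded_bilinear.has_vector_derivative[OF bounded_bilinear_inner assms assms]
  by (simp add: has_real_derivative_iff_has_vector_derivative inner_commute)

text \<open>Gronwall's argument: the weighted square
  \<open>exp (- 2 * L * t) * (norm (X t - Z t))\<^sup>2\<close> is nonincreasing and vanishes at
  time 0.\<close>

lemma global_lipschitz_ode_unique: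
  fixes f :: "'a::real_inner \<Rightarrow> 'a"
  assumes lip: "\<And>x y. norm (f x - f y) \<le> L * norm (x - y)"
    and X: "\<And>t. t \<ge> 0 \<Longrightarrow> (X has_vector_derivative f (X t)) (at t within {0..})"
    and Z: "\<And>t. t \<ge> 0 \<Longrightarrow> (Z has_vector_derivative f (Z t)) (at t within {0..})"
    and "X 0 = Z 0" "t \<ge> 0"
  shows "X t = Z t"
proof -
  define h where "h t = exp (- 2 * L * t) * (norm (X t - Z t))\<^sup>2" for t
  define h' where "h' t = exp (- 2 * L * t) * (2 * inner (X t - Z t) (f (X t) - f (Z t)) - 2 * L * (norm (X t - Z t))\<^sup>2)" for t
  have "h t \<le> h 0"
  proof (rule halfline_deriv_nonpos_imp_le[where h = h and h' = h'])
    show "(h has_real_derivative h' s) (at s within {0..})" if "s \<ge> 0" for s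
    proof -
      have "((\<lambda>s. exp (- 2 * L * s)) has_real_derivative - 2 * L * exp (- 2 * L * s)) (at s within {0..})"
        by (auto intro!: derivative_eq_intros)
      from DERIV_mult[OF this has_real_derivative_norm_square[OF has_vector_derivative_diff[OF X[OF that] Z[OF that]]]]
      show ?thesis
        unfolding h_def h'_def by (rule DERIV_cong) (simp add: algebra_simps)
    qed
    show "h' s \<le> 0" for s
    proof -
      have "inner (X s - Z s) (f (X s) - f (Z s)) \<le> norm (X s - Z s) * (L * norm (X s - Z s))"
        by (meson lip mult_left_mono norm_cauchy_schwarz norm_ge_zero order_trans)
      then show ?thesis
        unfolding h'_def by (intro mult_nonneg_nonpos) (simp_all add: power2_eq_square algebra_simps)
    qed
  qed (use assms in auto)
  then have "exp (- 2 * L * t) * (norm (X t - Z t))\<^sup>2 \<le> 0"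
    by (simp add: h_def \<open>X 0 = Z 0\<close>)
  then show ?thesis
    by (simp add: mult_le_0_iff)
qed

section \<open>Weak convergence\<close>

text \<open>Tychonoff's theorem gives a cluster point of the functionals \<open>inner (f t)\<close> in the product
  topology; it is linear and bounded, hence represented by a vector.\<close>

lemma weakly_convergent_subfilter:
  fixes f :: "'b \<Rightarrow> 'a::{real_inner,complete_space}"
  assumes "F \<noteq> bot" and bdd: "eventually (\<lambda>t. norm (f t) \<le> M) F"
  obtains F' l where "F' \<noteq> bot" "F' \<le> F" "weakly_tendsto f l F'"
proof -
  define \<Phi> where "\<Phi> t = (\<lambda>y. inner (f t) y)" for t
  define U where "U = (PiE UNIV (\<lambda>y::'a. {- (M * norm y)..M * norm y}))"
  have "compactin (product_topology (\<lambda>_. euclidean) UNIV) U"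
    unfolding U_def compactin_PiE by simp
  then have "compact U"
    by (simp add: euclidean_product_topology)
  moreover have "filtermap \<Phi> F \<noteq> bot"
    using \<open>F \<noteq> bot\<close> by (simp add: filtermap_bot_iff)
  moreover have "eventually (\<lambda>z. z \<in> U) (filtermap \<Phi> F)"
    unfolding eventually_filtermap using bdd
  proof eventually_elim
    case (elim t)
    have "\<bar>inner (f t) y\<bar> \<le> M * norm y" for y
      using Cauchy_Schwarz_ineq2[of "f t" y] mult_right_mono[OF elim, of "norm y"] by simp
    then show ?case by (auto simp: U_def \<Phi>_def PiE_iff abs_le_iff minus_le_iff)
  qed
  ultimately obtain \<phi> where \<phi>: "inf (nhds \<phi>) (filtermap \<Phi> F) \<noteq> bot"
    unfolding compact_filter by blast
  \<comment> \<open>Intersecting \<open>F\<close> with the preimages of the neighbourhoods of \<phi>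
    turns the cluster point into a limit along a finer filter, in the role of a subnet.\<close>
  define F' where "F' = inf F (filtercomap \<Phi> (nhds \<phi>))"
  have "F' \<noteq> bot"
  proof
    assume "F' = bot"
    then obtain P Q where PQ: "eventually P F" "eventually Q (filtercomap \<Phi> (nhds \<phi>))" "\<And>x. P x \<Longrightarrow> Q x \<Longrightarrow> False"
      unfolding F'_def trivial_limit_def eventually_inf by blast
    then obtain R where R: "eventually R (nhds \<phi>)" "\<And>x. R (\<Phi> x) \<Longrightarrow> Q x"
      unfolding eventually_filtercomap by blast
    have "eventually (\<lambda>z. \<not> R z) (filtermap \<Phi> F)"
      unfolding eventually_filtermap using PQ(1) by eventually_elim (use PQ(3) R(2) in blast)
    with R(1) have "eventually (\<lambda>_. False) (inf (nhds \<phi>) (filtermap \<Phi> F))"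
      unfolding eventually_inf by blast
    then show False using \<phi> by (simp add: trivial_limit_def)
  qed
  have "F' \<le> F" by (simp add: F'_def)
  have "filterlim \<Phi> (nhds \<phi>) F'"
    unfolding filterlim_def F'_def
    by (meson filtermap_filtercomap filtermap_mono inf_le2 order_trans)
  then have lim: "((\<lambda>t. inner (f t) y) \<longlongrightarrow> \<phi> y) F'" for y
    using continuous_on_tendsto_compose[OF continuous_on_product_coordinates[of y] \<open>filterlim \<Phi> (nhds \<phi>) F'\<close>]
    by (simp add: \<Phi>_def)
  have "bounded_linear \<phi>"
  proof (rule bounded_linear_intro)
    show "\<phi> (x + y) = \<phi> x + \<phi> y" for x y
      using tendsto_unique[OF \<open>F' \<noteq> bot\<close> lim[of "x + y"]] tendsto_add[OF lim[of x] lim[of y]]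
      by (simp add: inner_add_right)
    show "\<phi> (r *\<^sub>R x) = r *\<^sub>R \<phi> x" for r x
      using tendsto_unique[OF \<open>F' \<noteq> bot\<close> lim[of "r *\<^sub>R x"]] tendsto_mult_left[OF lim[of x], of r]
      by simp
    show "norm (\<phi> y) \<le> norm y * M" for y
    proof (rule tendsto_upperbound[OF tendsto_norm[OF lim] _ \<open>F' \<noteq> bot\<close>])
      show "eventually (\<lambda>t. norm (inner (f t) y) \<le> norm y * M) F'"
        using filter_leD[OF \<open>F' \<le> F\<close> bdd]
      proof eventually_elim
        case (elim t)
        then show ?case
          using Cauchy_Schwarz_ineq2[of "f t" y] mult_right_mono[OF elim, of "norm y"]
          by (simp add: mult.commute)
      qed
    qed
  qed
  then obtain l where l: "\<And>y. \<phi> y = inner l y"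
    by (rule riesz_representation) (rule that)
  have "weakly_tendsto f l F'"
    unfolding weakly_tendsto_def using lim by (simp add: l)
  with \<open>F' \<noteq> bot\<close> \<open>F' \<le> F\<close> show thesis by (rule that)
qed

text \<open>If \<open>x\<close> and \<open>y\<close> are weak cluster points,
  \<open>inner (u t) (x - y)\<close> is an affine combination of the squared distances to
  \<open>x\<close> and \<open>y\<close>, both in \<open>S\<close>. It therefore converges along
  \<open>F\<close>, which forces \<open>x = y\<close>. A bounded family with only one weak cluster
  point converges weakly.\<close>

lemma opial:
  fixes u :: "'b \<Rightarrow> 'a::{real_inner,complete_space}"
  assumes "F \<noteq> bot" "S \<noteq> {}"
    and conv: "\<And>z. z \<in> S \<Longrightarrow> \<exists>d. ((\<lambda>t. norm (u t - z)) \<longlongrightarrow> d) F"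
    and cluster: "\<And>F' l. F' \<noteq> bot \<Longrightarrow> F' \<le> F \<Longrightarrow> weakly_tendsto u l F' \<Longrightarrow> l \<in> S"
  obtains l where "l \<in> S" "weakly_tendsto u l F"
proof -
  obtain z d where z: "z \<in> S" "((\<lambda>t. norm (u t - z)) \<longlongrightarrow> d) F"
    using \<open>S \<noteq> {}\<close> conv by blast
  have "eventually (\<lambda>t. norm (u t - z) < d + 1) F"
    using z(2) by (rule order_tendstoD) simp
  then have bdd: "eventually (\<lambda>t. norm (u t) \<le> norm z + d + 1) F"
  proof eventually_elim
    case (elim t)
    then show ?case using norm_triangle_ineq[of "u t - z" z] by simp
  qed
  have unique: "x = y"
    if F1: "F1 \<noteq> bot" "F1 \<le> F" "weakly_tendsto u x F1" and F2: "F2 \<noteq> bot" "F2 \<le> F" "weakly_tendsto u y F2"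
    for F1 F2 x y
  proof -
    have "x \<in> S" "y \<in> S"
      using F1 F2 cluster by auto
    then obtain a b where ab: "((\<lambda>t. norm (u t - x)) \<longlongrightarrow> a) F" "((\<lambda>t. norm (u t - y)) \<longlongrightarrow> b) F"
      using conv by blast
    have "inner (u t) (x - y) = ((norm (u t - y))\<^sup>2 - (norm (u t - x))\<^sup>2 + (norm x)\<^sup>2 - (norm y)\<^sup>2) / 2" for t
      by (simp add: power2_norm_eq_inner inner_simps inner_commute)
    moreover have "((\<lambda>t. ((norm (u t - y))\<^sup>2 - (norm (u t - x))\<^sup>2 + (norm x)\<^sup>2 - (norm y)\<^sup>2) / 2)
        \<longlongrightarrow> (b\<^sup>2 - a\<^sup>2 + (norm x)\<^sup>2 - (norm y)\<^sup>2) / 2) F"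
      by (intro tendsto_intros ab) auto
    ultimately have lim: "((\<lambda>t. inner (u t) (x - y)) \<longlongrightarrow> (b\<^sup>2 - a\<^sup>2 + (norm x)\<^sup>2 - (norm y)\<^sup>2) / 2) F"
      by (simp only:)
    have "inner x (x - y) = inner y (x - y)"
      using tendsto_unique[OF F1(1) _ tendsto_mono[OF F1(2) lim]] F1(3)
        tendsto_unique[OF F2(1) _ tendsto_mono[OF F2(2) lim]] F2(3)
      unfolding weakly_tendsto_def by metis
    then have "inner (x - y) (x - y) = 0"
      by (simp add: inner_diff_left)
    then show ?thesis by simp
  qed
  obtain F0 l where F0: "F0 \<noteq> bot" "F0 \<le> F" "weakly_tendsto u l F0"
    using weakly_convergent_subfilter[OF \<open>F \<noteq> bot\<close> bdd] .
  have "weakly_tendsto u l F"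
    unfolding weakly_tendsto_def
  proof (intro allI tendstoI)
    fix y and e :: real assume "e > 0"
    show "eventually (\<lambda>t. dist (inner (u t) y) (inner l y) < e) F"
    proof (rule ccontr)
      assume not_ev: "\<not> ?thesis"
      \<comment> \<open>If convergence failed in direction \<open>y\<close>, \<open>F\<close> could
        be restricted to the times where the error is at least \<open>e\<close>. A weak cluster
        point along that restriction equals \<open>l\<close>, a contradiction.\<close>
      define G where "G = inf F (principal {t. \<not> dist (inner (u t) y) (inner l y) < e})"
      have "G \<noteq> bot"
        using not_ev by (simp add: G_def trivial_limit_def eventually_inf_principal)
      have "G \<le> F" by (simp add: G_def)
      obtain G' m where G': "G' \<noteq> bot" "G' \<le> G" "weakly_tendsto u m G'"
        using weakly_convergent_subfilter[OF \<open>G \<noteq> bot\<close> filter_leD[OF \<open>G \<le> F\<close> bdd]] .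
      then have "m = l"
        using unique[OF G'(1) _ G'(3) F0] \<open>G \<le> F\<close> by simp
      then have "eventually (\<lambda>t. dist (inner (u t) y) (inner l y) < e) G'"
        using G'(3) \<open>e > 0\<close> unfolding weakly_tendsto_def by (metis tendstoD)
      moreover have "eventually (\<lambda>t. \<not> dist (inner (u t) y) (inner l y) < e) G'"
        using G'(2) by (rule filter_leD) (simp add: G_def eventually_inf_principal)
      ultimately have "eventually (\<lambda>t. False) G'"
        by eventually_elim simp
      then show False using G'(1) by (simp add: trivial_limit_def)
    qed
  qed
  with cluster[OF F0] show thesis by (intro that)
qed

section \<open>Energy estimates for the damped equation\<close>

lemma nonincreasing_halfline_convergent:
  fixes h :: "real \<Rightarrow> real"
  assumes mono: "\<And>s t. 0 \<le> s \<Longrightarrow> s \<le> t \<Longrightarrow> h t \<le> h s" and bound: "\<And>t. t \<ge> 0 \<Longrightarrow> B \<le> h t"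
  obtains L where "(h \<longlongrightarrow> L) at_top"
proof -
  have bdd: "bdd_below (h ` {0..})"
    using bound by (intro bdd_belowI[of _ B]) auto
  have "(h \<longlongrightarrow> Inf (h ` {0..})) at_top"
  proof (rule order_tendstoI)
    fix a assume "a < Inf (h ` {0..})"
    then have "\<forall>t\<ge>0. a < h t"
      using bdd by (meson atLeast_iff cInf_lower imageI less_le_trans)
    then show "eventually (\<lambda>t. a < h t) at_top"
      by (auto simp: eventually_at_top_linorder)
  next
    fix a assume "Inf (h ` {0..}) < a"
    then obtain s where "s \<ge> 0" "h s < a"
      using bdd by (subst (asm) cInf_less_iff) auto
    then have "\<forall>t\<ge>s. h t < a"
      using mono by (meson le_less_trans)
    then show "eventually (\<lambda>t. h t < a) at_top"
      by (auto simp: eventually_at_top_linorder)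
  qed
  then show thesis by (rule that)
qed

context
  fixes A :: "'h::{real_inner,complete_space} \<Rightarrow> 'h set" and l \<gamma> :: real and u v :: "real \<Rightarrow> 'h"
  assumes A: "maximal_monotone A" and l: "l > 0" and \<gamma>: "\<gamma> > 0" and l\<gamma>: "l * \<gamma>\<^sup>2 > 1"
    and u': "\<And>t. t \<ge> 0 \<Longrightarrow> (u has_vector_derivative v t) (at t within {0..})"
    and v': "\<And>t. t \<ge> 0 \<Longrightarrow> (v has_vector_derivative - (\<gamma> *\<^sub>R v t) - yosida l A (u t)) (at t within {0..})"
begin

private abbreviation Y where "Y \<equiv> yosida l A"

text \<open>The acceleration, with the equation substituted for the derivative of
  \<open>v\<close>.\<close>

private definition a where "a t = - (\<gamma> *\<^sub>R v t) - Y (u t)"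

text \<open>The smaller of the two dissipation coefficients, of acceleration and of
  velocity.\<close>

private definition c where "c = min l (l * \<gamma>\<^sup>2 - 1)"

text \<open>With \<open>h t = \<bar>u t - z\<bar>\<^sup>2 / 2\<close> this is \<open>h' + \<gamma> h + l \<gamma> \<bar>v\<bar>\<^sup>2\<close>.\<close>

private definition E where
  "E z t = inner (u t - z) (v t) + \<gamma> / 2 * (norm (u t - z))\<^sup>2 + l * \<gamma> * (norm (v t))\<^sup>2"

private definition E' where
  "E' z t = (norm (v t))\<^sup>2 - inner (u t - z) (Y (u t)) + 2 * l * \<gamma> * inner (v t) (a t)"

private lemma c_pos: "c > 0"
  using l l\<gamma> by (simp add: c_def)

section \<open>Energy: derivative, dissipation and coercivity\<close>

text \<open>The damping contributes \<open>- \<gamma> * inner (u t - z) (v t)\<close>, which cancels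
  the derivative of the term \<open>\<gamma> / 2 * (norm (u t - z))\<^sup>2\<close>.\<close>

private lemma energy_has_derivative:
  assumes "t \<ge> 0"
  shows "(E z has_real_derivative E' z t) (at t within {0..})"
proof -
  have uz: "((\<lambda>t. u t - z) has_vector_derivative v t) (at t within {0..})"
    using u'[OF assms] by (auto intro!: derivative_eq_intros)
  have va: "(v has_vector_derivative a t) (at t within {0..})"
    unfolding a_def by (rule v'[OF assms])
  have "((\<lambda>t. inner (u t - z) (v t)) has_real_derivative inner (u t - z) (a t) + inner (v t) (v t)) (at t within {0..})"
    using bounded_bilinear.has_vector_derivative[OF bounded_bilinear_inner uz va]
    by (simp add: has_real_derivative_iff_has_vector_derivative)
  from DERIV_add[OF DERIV_add[OF this DERIV_cmult[OF has_real_derivative_norm_square[OF uz], of "\<gamma> / 2"]]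
      DERIV_cmult[OF has_real_derivative_norm_square[OF va], of "l * \<gamma>"]]
  moreover have "inner (u t - z) (a t) = - \<gamma> * inner (u t - z) (v t) - inner (u t - z) (Y (u t))"
    by (simp add: a_def inner_diff_right)
  ultimately show ?thesis
    unfolding E_def E'_def
    by (elim DERIV_cong) (simp add: power2_norm_eq_inner)
qed

text \<open>Cocoercivity against \<open>Y z = 0\<close> bounds
  \<open>inner (u t - z) (Y (u t))\<close> below by \<open>l \<bar>Y (u t)\<bar>\<^sup>2\<close>.
  Expanding \<open>Y (u t) = - (a t + \<gamma> v t)\<close> yields a cross term that cancels the one
  in \<open>E'\<close>; the weight \<open>l * \<gamma>\<close> in \<open>E\<close> is chosen for
  this.\<close>

private lemma energy_dissipation:
  assumes "0 \<in> A z"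
  shows "E' z t \<le> - c * ((norm (v t))\<^sup>2 + (norm (a t))\<^sup>2)"
proof -
  have "l * (norm (Y (u t)))\<^sup>2 \<le> inner (u t - z) (Y (u t))"
    using yosida_cocoercive[OF A l, of "u t" z] yosida_zero[OF A l assms] by (simp add: inner_commute)
  moreover have "l * (norm (Y (u t)))\<^sup>2 = l * (norm (a t))\<^sup>2 + 2 * l * \<gamma> * inner (v t) (a t) + l * \<gamma>\<^sup>2 * (norm (v t))\<^sup>2"
    unfolding a_def power2_norm_eq_inner
    by (simp add: inner_simps inner_commute power2_eq_square algebra_simps)
  ultimately have "E' z t \<le> - (l * (norm (a t))\<^sup>2 + (l * \<gamma>\<^sup>2 - 1) * (norm (v t))\<^sup>2)"
    by (simp add: E'_def algebra_simps)
  moreover have "c * (norm (a t))\<^sup>2 \<le> l * (norm (a t))\<^sup>2" "c * (norm (v t))\<^sup>2 \<le> (l * \<gamma>\<^sup>2 - 1) * (norm (v t))\<^sup>2"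
    by (auto simp: c_def intro!: mult_right_mono)
  ultimately show ?thesis by (simp add: algebra_simps)
qed

text \<open>Completing the square in \<open>u t - z\<close> leaves the coefficient
  \<open>l * \<gamma> - 1 / (2 * \<gamma>)\<close> on \<open>\<bar>v\<bar>\<^sup>2\<close>, and
  \<open>l * \<gamma>\<^sup>2 > 1\<close> makes it at least \<open>l * \<gamma> / 2\<close>.\<close>

private lemma energy_lower_bound:
  "E z t \<ge> \<gamma> / 2 * (norm (u t - z + (1 / \<gamma>) *\<^sub>R v t))\<^sup>2 + l * \<gamma> / 2 * (norm (v t))\<^sup>2"
proof -
  have "E z t = \<gamma> / 2 * (norm (u t - z + (1 / \<gamma>) *\<^sub>R v t))\<^sup>2 + (l * \<gamma> - 1 / (2 * \<gamma>)) * (norm (v t))\<^sup>2"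
  proof -
    define w where "w = u t - z"
    have "(norm (w + (1 / \<gamma>) *\<^sub>R v t))\<^sup>2 = (norm w)\<^sup>2 + 2 / \<gamma> * inner w (v t) + (norm (v t))\<^sup>2 / \<gamma>\<^sup>2"
      unfolding power2_norm_eq_inner
      by (simp add: inner_add_left inner_add_right inner_commute power2_eq_square)
    moreover have "\<gamma> / 2 * (W + 2 / \<gamma> * I + V / \<gamma>\<^sup>2) + (l * \<gamma> - 1 / (2 * \<gamma>)) * V = I + \<gamma> / 2 * W + l * \<gamma> * V"
      for I V W :: real
      using \<gamma> by (simp add: power2_eq_square field_simps)
    ultimately show ?thesis
      unfolding E_def w_def[symmetric] by simp
  qed
  moreover have "l * \<gamma> / 2 * (norm (v t))\<^sup>2 \<le> (l * \<gamma> - 1 / (2 * \<gamma>)) * (norm (v t))\<^sup>2"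
  proof (rule mult_right_mono)
    have "1 / \<gamma> \<le> l * \<gamma>"
      using \<gamma> l\<gamma> by (simp add: divide_le_eq power2_eq_square mult.assoc)
    moreover have "1 / (2 * \<gamma>) = (1 / \<gamma>) / 2" by simp
    ultimately show "l * \<gamma> / 2 \<le> l * \<gamma> - 1 / (2 * \<gamma>)" by linarith
  qed simp
  ultimately show ?thesis by simp
qed

private lemma energy_nonneg: "E z t \<ge> 0"
proof -
  have "0 \<le> \<gamma> / 2 * (norm (u t - z + (1 / \<gamma>) *\<^sub>R v t))\<^sup>2 + l * \<gamma> / 2 * (norm (v t))\<^sup>2"
    using l \<gamma> by simp
  also have "\<dots> \<le> E z t"
    by (rule energy_lower_bound)
  finally show ?thesis .
qed

private lemma velocity_square_bound: "(norm (v t))\<^sup>2 \<le> 2 / (l * \<gamma>) * E z t"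
proof -
  have "l * \<gamma> / 2 * (norm (v t))\<^sup>2 \<le> E z t"
    using energy_lower_bound[of t z] \<gamma> by (smt (verit) divide_nonneg_nonneg mult_nonneg_nonneg zero_le_power2)
  then show ?thesis using l \<gamma> by (simp add: field_simps)
qed

private lemma energy_nonincreasing:
  assumes "0 \<in> A z" "0 \<le> s" "s \<le> t"
  shows "E z t \<le> E z s"
proof (rule halfline_deriv_nonpos_imp_le[where h = "E z" and h' = "E' z"])
  show "E' z r \<le> 0" for r
  proof -
    have "0 \<le> c * ((norm (v r))\<^sup>2 + (norm (a r))\<^sup>2)" using c_pos by simp
    then show ?thesis
      using energy_dissipation[OF assms(1), of r] by simp
  qed
qed (use assms energy_has_derivative in auto)

private lemma energy_convergent:
  assumes "0 \<in> A z"
  obtains L where "(E z \<longlongrightarrow> L) at_top"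
  using nonincreasing_halfline_convergent[OF energy_nonincreasing[OF assms] energy_nonneg] .

section \<open>Integrability and decay of the velocity\<close>

text \<open>For the primitive \<open>P\<close> of \<open>\<bar>v\<bar>\<^sup>2\<close>, the sum
  \<open>E + c P\<close> decreases and \<open>E\<close> is nonnegative, so the nondecreasing
  \<open>P\<close> is bounded. A convergent primitive serves both the decay of \<open>v\<close> and
  the integrability of \<open>\<bar>v\<bar>\<^sup>2\<close>.\<close>

lemma damped_kinetic_energy_primitive:
  assumes z: "0 \<in> A z"
  obtains P Q where "P 0 = 0" "(P \<longlongrightarrow> Q) at_top"
    "\<And>t. t \<ge> 0 \<Longrightarrow> (P has_real_derivative (norm (v t))\<^sup>2) (at t within {0..})"
proof -
  have "continuous_on {0..} v"
    using v' by (meson atLeast_iff continuous_on_eq_continuous_within has_vector_derivative_continuous)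
  then have "continuous_on {0..} (\<lambda>t. (norm (v t))\<^sup>2)"
    by (intro continuous_intros)
  then obtain P where P0: "P 0 = 0"
      and "\<And>t. t \<ge> 0 \<Longrightarrow> (P has_vector_derivative (norm (v t))\<^sup>2) (at t within {0..})"
    by (rule antiderivative_halfline) (rule that)
  then have P: "\<And>t. t \<ge> 0 \<Longrightarrow> (P has_real_derivative (norm (v t))\<^sup>2) (at t within {0..})"
    by (simp add: has_real_derivative_iff_has_vector_derivative)
  have bound: "c * P t \<le> E z 0" if "t \<ge> 0" for t
  proof -
    have "E z t + c * P t \<le> E z 0 + c * P 0"
    proof (rule halfline_deriv_nonpos_imp_le[where h = "\<lambda>t. E z t + c * P t" and h' = "\<lambda>t. E' z t + c * (norm (v t))\<^sup>2"])
      show "((\<lambda>t. E z t + c * P t) has_real_derivative E' z t + c * (norm (v t))\<^sup>2) (at t within {0..})" if "t \<ge> 0" for t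
        by (intro DERIV_add DERIV_cmult energy_has_derivative P that)
      show "E' z t + c * (norm (v t))\<^sup>2 \<le> 0" for t
      proof -
        have "0 \<le> c * (norm (a t))\<^sup>2" using c_pos by simp
        then show ?thesis
          using energy_dissipation[OF z, of t] by (simp add: algebra_simps)
      qed
    qed (use that in auto)
    then show ?thesis
      using energy_nonneg[of z t] P0 by simp
  qed
  have "- P t \<le> - P s" if "0 \<le> s" "s \<le> t" for s t
    by (rule halfline_deriv_nonpos_imp_le[where h = "\<lambda>t. - P t" and h' = "\<lambda>t. - (norm (v t))\<^sup>2"])
      (use that in \<open>auto intro!: DERIV_minus P\<close>)
  moreover have "- (E z 0 / c) \<le> - P t" if "t \<ge> 0" for t
    using bound[OF that] c_pos by (simp add: pos_le_divide_eq mult.commute)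
  ultimately obtain Q where "((\<lambda>t. - P t) \<longlongrightarrow> Q) at_top"
    by (rule nonincreasing_halfline_convergent[of "\<lambda>t. - P t"]) auto
  then have "(P \<longlongrightarrow> - Q) at_top"
    using tendsto_minus_cancel_left by blast
  with P0 show thesis using P by (rule that)
qed

text \<open>The derivative of \<open>\<bar>v\<bar>\<^sup>2\<close> is at most \<open>\<bar>v\<bar>\<^sup>2 + \<bar>a\<bar>\<^sup>2\<close>, so \<open>E + c \<bar>v\<bar>\<^sup>2\<close> still decreases and \<open>\<bar>v\<bar>\<^sup>2\<close>
  converges; its limit is \<open>0\<close> because its primitive is bounded.\<close>

lemma damped_velocity_tendsto_0:
  assumes z: "0 \<in> A z"
  shows "(v \<longlongrightarrow> 0) at_top"
proof -
  obtain L where L: "(E z \<longlongrightarrow> L) at_top"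
    using energy_convergent[OF z] .
  define h where "h t = E z t + c * (norm (v t))\<^sup>2" for t
  have "h t \<le> h s" if "0 \<le> s" "s \<le> t" for s t
  proof (rule halfline_deriv_nonpos_imp_le[where h = h and h' = "\<lambda>t. E' z t + c * (2 * inner (v t) (a t))"])
    show "(h has_real_derivative E' z t + c * (2 * inner (v t) (a t))) (at t within {0..})" if "t \<ge> 0" for t
      unfolding h_def a_def
      by (intro DERIV_add DERIV_cmult energy_has_derivative[unfolded a_def] has_real_derivative_norm_square v' that)
    show "E' z t + c * (2 * inner (v t) (a t)) \<le> 0" for t
    proof -
      have "0 \<le> c * (norm (v t - a t))\<^sup>2" using c_pos by simp
      moreover have "(norm (v t - a t))\<^sup>2 = (norm (v t))\<^sup>2 + (norm (a t))\<^sup>2 - 2 * inner (v t) (a t)"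
        by (simp add: power2_norm_eq_inner inner_diff_left inner_diff_right inner_commute)
      ultimately show ?thesis
        using energy_dissipation[OF z, of t] by (simp add: algebra_simps)
    qed
  qed (use that in auto)
  moreover have "0 \<le> h t" for t
    using energy_nonneg[of z t] c_pos by (simp add: h_def)
  ultimately obtain M where M: "(h \<longlongrightarrow> M) at_top"
    by (rule nonincreasing_halfline_convergent)
  define G where "G = (M - L) / c"
  have "((\<lambda>t. (h t - E z t) / c) \<longlongrightarrow> G) at_top"
    unfolding G_def using c_pos by (intro tendsto_intros L M) auto
  then have G: "((\<lambda>t. (norm (v t))\<^sup>2) \<longlongrightarrow> G) at_top"
    using c_pos by (simp add: h_def)
  obtain P Q where Q: "(P \<longlongrightarrow> Q) at_top"
    and P: "\<And>t. t \<ge> 0 \<Longrightarrow> (P has_real_derivative (norm (v t))\<^sup>2) (at t within {0..})"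
    using damped_kinetic_energy_primitive[OF z] by metis
  \<comment> \<open>The mean value theorem on \<open>[t, t + 1]\<close> samples
    \<open>\<bar>v\<bar>\<^sup>2\<close> at times beyond \<open>t\<close>. The increments of the
    convergent \<open>P\<close> tend to 0, so the limit \<open>G\<close> can only be 0.\<close>
  have "\<exists>x. t < x \<and> P (t + 1) - P t = (norm (v x))\<^sup>2" if "t > 0" for t
  proof -
    have "(P has_real_derivative (norm (v x))\<^sup>2) (at x)" if "t \<le> x" for x
      using P[of x] that \<open>t > 0\<close> at_within_interior[of x "{0..}"] by simp
    then obtain x where "t < x" "P (t + 1) - P t = (t + 1 - t) * (norm (v x))\<^sup>2"
      using MVT2[of t "t + 1" P "\<lambda>x. (norm (v x))\<^sup>2"] by auto
    then show ?thesis by auto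
  qed
  then obtain \<xi> where \<xi>: "\<And>t. t > 0 \<Longrightarrow> t < \<xi> t" "\<And>t. t > 0 \<Longrightarrow> P (t + 1) - P t = (norm (v (\<xi> t)))\<^sup>2"
    by metis
  have pos: "eventually (\<lambda>t::real. t > 0) at_top"
    by (rule eventually_gt_at_top)
  have "filterlim \<xi> at_top at_top"
    by (rule filterlim_at_top_mono[OF filterlim_ident], use pos in eventually_elim) (auto dest: \<xi>(1))
  with G have lim\<xi>: "((\<lambda>t. (norm (v (\<xi> t)))\<^sup>2) \<longlongrightarrow> G) at_top"
    by (rule filterlim_compose)
  have "filterlim (\<lambda>t::real. t + 1) at_top at_top"
    by (rule filterlim_at_top_mono[OF filterlim_ident]) auto
  with Q have "((\<lambda>t. P (t + 1)) \<longlongrightarrow> Q) at_top"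
    by (rule filterlim_compose)
  with Q have "((\<lambda>t. P (t + 1) - P t) \<longlongrightarrow> Q - Q) at_top"
    by (intro tendsto_diff)
  then have "((\<lambda>t. (norm (v (\<xi> t)))\<^sup>2) \<longlongrightarrow> Q - Q) at_top"
    by (rule Lim_transform_eventually) (use pos in eventually_elim, auto simp: \<xi>(2))
  then have "G = 0"
    using tendsto_unique[OF _ lim\<xi>] by fastforce
  then have "((\<lambda>t. sqrt ((norm (v t))\<^sup>2)) \<longlongrightarrow> sqrt 0) at_top"
    using G by (intro tendsto_real_sqrt) simp
  then show ?thesis
    by (simp add: tendsto_norm_zero_iff)
qed

text \<open>Integrating \<open>v' = - \<gamma> v - Y u\<close> over \<open>[t, t + 1]\<close>, where \<open>Y u\<close> is nearly constant.\<close>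

private lemma yosida_tendsto_0:
  assumes z: "0 \<in> A z"
  shows "((\<lambda>t. Y (u t)) \<longlongrightarrow> 0) at_top"
proof (rule tendstoI)
  fix e :: real assume "e > 0"
  \<comment> \<open>The summands are 2 for the velocities at both ends of the unit interval,
    \<gamma> for the damping and \<open>1 / l\<close> for the Lipschitz constant of
    \<open>Y\<close>. With \<open>m = e / (2 * C)\<close> the total error \<open>C * m\<close> is
    \<open>e / 2\<close>.\<close>
  define C where "C = 2 + \<gamma> + 1 / l"
  have "C > 0" using \<gamma> l by (simp add: C_def add_pos_pos)
  define m where "m = e / (2 * C)"
  have "m > 0" using \<open>e > 0\<close> \<open>C > 0\<close> by (simp add: m_def)
  then have "eventually (\<lambda>t. dist (v t) 0 < m) at_top"
    using damped_velocity_tendsto_0[OF z] by (intro tendstoD)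
  then obtain T where T: "\<And>t. t \<ge> T \<Longrightarrow> norm (v t) < m"
    by (auto simp: eventually_at_top_linorder)
  have "norm (Y (u t)) < e" if t: "t \<ge> max T 0" for t
  proof -
    have u_bound: "norm (u s - u t) \<le> m" if "s \<ge> t" "s \<le> t + 1" for s
    proof -
      have "norm (u s - u t) \<le> m * (s - t)"
        by (rule halfline_mean_value_bound[OF u']) (use that t in \<open>auto intro!: less_imp_le[OF T]\<close>)
      also have "\<dots> \<le> m" using that \<open>m > 0\<close> by simp
      finally show ?thesis .
    qed
    \<comment> \<open>Adding a linear function with slope \<open>Y (u t)\<close>, frozen at time
      \<open>t\<close>, leaves a derivative made of the damping and of the increment of
      \<open>Y\<close>, both small.\<close>
    have "norm ((v (t + 1) + (t + 1) *\<^sub>R Y (u t)) - (v t + t *\<^sub>R Y (u t))) \<le> ((\<gamma> + 1 / l) * m) * (t + 1 - t)"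
    proof (rule halfline_mean_value_bound)
      show "((\<lambda>s. v s + s *\<^sub>R Y (u t)) has_vector_derivative (- (\<gamma> *\<^sub>R v s) - Y (u s)) + Y (u t)) (at s within {0..})" if "s \<ge> 0" for s
        using v'[OF that] by (auto intro!: derivative_eq_intros)
      show "norm (- (\<gamma> *\<^sub>R v s) - Y (u s) + Y (u t)) \<le> (\<gamma> + 1 / l) * m" if "t < s" "s < t + 1" for s
      proof -
        have "norm (- (\<gamma> *\<^sub>R v s) - Y (u s) + Y (u t)) \<le> norm (\<gamma> *\<^sub>R v s) + norm (Y (u s) - Y (u t))"
          using norm_triangle_ineq4[of "- (\<gamma> *\<^sub>R v s)" "Y (u s) - Y (u t)"] by (simp add: algebra_simps)
        also have "\<dots> \<le> \<gamma> * m + m / l"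
        proof (rule add_mono)
          show "norm (\<gamma> *\<^sub>R v s) \<le> \<gamma> * m"
            using T[of s] t that \<gamma> by simp
          show "norm (Y (u s) - Y (u t)) \<le> m / l"
            using yosida_lipschitz[OF A l, of "u s" "u t"] u_bound[of s] that l
            by (meson divide_right_mono less_imp_le order_trans)
        qed
        finally show ?thesis by (simp add: algebra_simps)
      qed
    qed (use t in auto)
    then have "norm (Y (u t) + (v (t + 1) - v t)) \<le> (\<gamma> + 1 / l) * m"
      by (simp add: algebra_simps)
    then have "norm (Y (u t)) \<le> (\<gamma> + 1 / l) * m + norm (v (t + 1) - v t)"
      using norm_triangle_ineq4[of "Y (u t) + (v (t + 1) - v t)" "v (t + 1) - v t"] by simp
    also have "\<dots> \<le> (\<gamma> + 1 / l) * m + (m + m)"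
      using T[of t] T[of "t + 1"] t norm_triangle_ineq4[of "v (t + 1)" "v t"] by simp
    also have "\<dots> = C * m" by (simp add: C_def algebra_simps)
    also have "\<dots> < e" using \<open>C > 0\<close> \<open>e > 0\<close> by (simp add: m_def)
    finally show ?thesis .
  qed
  then show "eventually (\<lambda>t. dist (Y (u t)) 0 < e) at_top"
    by (auto simp: eventually_at_top_linorder intro!: exI[of _ "max T 0"])
qed

section \<open>Boundedness and weak convergence of the trajectory\<close>

text \<open>The initial energy bounds both \<open>u t - z + (1 / \<gamma>) *\<^sub>R v t\<close> and
  \<open>v t\<close>, hence also their combination \<open>u t - z\<close>.\<close>

private lemma trajectory_bounded:
  assumes z: "0 \<in> A z"
  obtains K where "\<And>t. t \<ge> 0 \<Longrightarrow> norm (u t - z) \<le> K"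
proof -
  define K1 K2 where "K1 = sqrt (2 / \<gamma> * E z 0)" and "K2 = sqrt (2 / (l * \<gamma>) * E z 0)"
  have "norm (u t - z) \<le> K1 + K2 / \<gamma>" if "t \<ge> 0" for t
  proof -
    have E0: "E z t \<le> E z 0"
      by (rule energy_nonincreasing[OF z]) (use that in auto)
    have "0 \<le> l * \<gamma> / 2 * (norm (v t))\<^sup>2"
      using l \<gamma> by simp
    then have "\<gamma> / 2 * (norm (u t - z + (1 / \<gamma>) *\<^sub>R v t))\<^sup>2 \<le> E z 0"
      using energy_lower_bound[of t z] E0 by linarith
    then have 1: "norm (u t - z + (1 / \<gamma>) *\<^sub>R v t) \<le> K1"
      unfolding K1_def using \<gamma> by (intro real_le_rsqrt) (simp add: field_simps)
    have "(norm (v t))\<^sup>2 \<le> 2 / (l * \<gamma>) * E z 0"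
      using velocity_square_bound[of t z] mult_left_mono[OF E0, of "2 / (l * \<gamma>)"] l \<gamma> by simp
    then have 2: "norm (v t) / \<gamma> \<le> K2 / \<gamma>"
      unfolding K2_def using \<gamma> by (intro divide_right_mono real_le_rsqrt) auto
    have "norm (u t - z) \<le> norm (u t - z + (1 / \<gamma>) *\<^sub>R v t) + norm ((1 / \<gamma>) *\<^sub>R v t)"
      using norm_triangle_ineq4[of "u t - z + (1 / \<gamma>) *\<^sub>R v t" "(1 / \<gamma>) *\<^sub>R v t"] by simp
    then show ?thesis
      using 1 2 \<gamma> by simp
  qed
  then show thesis by (rule that)
qed

text \<open>\<open>E z\<close> converges, while its terms containing \<open>v\<close> vanish in the
  limit because \<open>u\<close> is bounded and \<open>v\<close> tends to 0. Solving for the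
  remaining term isolates the distance.\<close>

private lemma distance_to_zero_convergent:
  assumes z: "0 \<in> A z"
  shows "\<exists>d. ((\<lambda>t. norm (u t - z)) \<longlongrightarrow> d) at_top"
proof -
  obtain L where L: "(E z \<longlongrightarrow> L) at_top"
    using energy_convergent[OF z] .
  obtain K where K: "\<And>t. t \<ge> 0 \<Longrightarrow> norm (u t - z) \<le> K"
    by (rule trajectory_bounded[OF z]) (rule that)
  have v: "((\<lambda>t. norm (v t)) \<longlongrightarrow> 0) at_top"
    using damped_velocity_tendsto_0[OF z] by (simp add: tendsto_norm_zero)
  have cross: "((\<lambda>t. inner (u t - z) (v t)) \<longlongrightarrow> 0) at_top"
  proof (rule Lim_null_comparison)
    show "eventually (\<lambda>t. norm (inner (u t - z) (v t)) \<le> K * norm (v t)) at_top"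
      using eventually_ge_at_top[of 0]
    proof eventually_elim
      case (elim t)
      then show ?case
        using Cauchy_Schwarz_ineq2[of "u t - z" "v t"] mult_right_mono[OF K, of t "norm (v t)"] by simp
    qed
    show "((\<lambda>t. K * norm (v t)) \<longlongrightarrow> 0) at_top"
      using tendsto_mult_right_zero[OF v] .
  qed
  have "((\<lambda>t. sqrt (2 / \<gamma> * (E z t - inner (u t - z) (v t) - l * \<gamma> * (norm (v t))\<^sup>2)))
      \<longlongrightarrow> sqrt (2 / \<gamma> * (L - 0 - l * \<gamma> * 0\<^sup>2))) at_top"
    by (intro tendsto_intros L cross v)
  moreover have "sqrt (2 / \<gamma> * (E z t - inner (u t - z) (v t) - l * \<gamma> * (norm (v t))\<^sup>2)) = norm (u t - z)" for t
    using \<gamma> by (simp add: E_def)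
  ultimately show ?thesis
    by (simp only:) blast
qed

text \<open>Opial's lemma applies once weak cluster points are known to be zeros of
  \<open>A\<close>. They are, because \<open>Y (u t)\<close> tends to 0 strongly and the graph of
  \<open>A\<close> is closed for weak convergence of points and strong convergence of
  values.\<close>

lemma damped_trajectory_weakly_convergent:
  assumes "operator_inverse A 0 \<noteq> {}"
  obtains p where "p \<in> operator_inverse A 0" "weakly_tendsto u p at_top"
proof (rule opial[of at_top "operator_inverse A 0" u])
  show "\<exists>d. ((\<lambda>t. norm (u t - z)) \<longlongrightarrow> d) at_top" if "z \<in> operator_inverse A 0" for z
    using that distance_to_zero_convergent by (simp add: operator_inverse_def)
  fix F p assume F: "F \<noteq> bot" "F \<le> at_top" and up: "weakly_tendsto u p F"
  obtain z where z: "0 \<in> A z"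
    using assms by (auto simp: operator_inverse_def)
  obtain K where K: "\<And>t. t \<ge> 0 \<Longrightarrow> norm (u t - z) \<le> K"
    by (rule trajectory_bounded[OF z]) (rule that)
  have Y0: "((\<lambda>t. Y (u t)) \<longlongrightarrow> 0) F"
    using yosida_tendsto_0[OF z] by (rule tendsto_mono[OF F(2)])
  have cross: "((\<lambda>t. inner (Y (u t)) (u t - z)) \<longlongrightarrow> 0) F"
  proof (rule Lim_null_comparison)
    have "eventually (\<lambda>t. t \<ge> 0) F"
      using F(2) by (rule filter_leD) (rule eventually_ge_at_top)
    then show "eventually (\<lambda>t. norm (inner (Y (u t)) (u t - z)) \<le> norm (Y (u t)) * K) F"
    proof eventually_elim
      case (elim t)
      then show ?case
        using Cauchy_Schwarz_ineq2[of "Y (u t)" "u t - z"] mult_left_mono[OF K, of t "norm (Y (u t))"] by simp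
    qed
    show "((\<lambda>t. norm (Y (u t)) * K) \<longlongrightarrow> 0) F"
      using tendsto_mult_left_zero[OF tendsto_norm_zero[OF Y0]] .
  qed
  have "0 \<in> A p"
  proof (rule maximal_monotone_memI[OF A])
    fix y b assume b: "b \<in> A y"
    \<comment> \<open>This is \<open>inner (Y (u t) - b) (u t - l *\<^sub>R Y (u t) - y)\<close>,
      split so that every summand has a limit. The product of \<open>Y (u t)\<close> with the only
      weakly convergent \<open>u t\<close> is isolated in the first summand, which tends to 0 by
      boundedness.\<close>
    define r where "r t = inner (Y (u t)) (u t - z) + inner (Y (u t)) (z - l *\<^sub>R Y (u t) - y)
        - inner (u t) b + inner (l *\<^sub>R Y (u t) + y) b" for t
    have "(r \<longlongrightarrow> 0 + inner 0 (z - l *\<^sub>R 0 - y) - inner p b + inner (l *\<^sub>R 0 + y) b) F"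
      unfolding r_def
      by (intro tendsto_add tendsto_diff cross up[unfolded weakly_tendsto_def, rule_format]
          tendsto_inner[OF Y0] tendsto_inner[OF _ tendsto_const, of "\<lambda>t. l *\<^sub>R Y (u t) + y"]
          tendsto_scaleR tendsto_const Y0)
    moreover have "r t \<ge> 0" for t
    proof -
      have "0 \<le> inner (Y (u t) - b) (u t - l *\<^sub>R Y (u t) - y)"
        using A b yosida_mem[OF A l, of "u t"] unfolding maximal_monotone_def monotone_operator_def by blast
      also have "\<dots> = r t"
        by (simp add: r_def inner_diff_left inner_diff_right inner_add_left inner_add_right inner_commute algebra_simps)
      finally show ?thesis .
    qed
    ultimately have "0 \<le> 0 + inner 0 (z - l *\<^sub>R 0 - y) - inner p b + inner (l *\<^sub>R 0 + y) b"
      using F(1) by (intro tendsto_lowerbound) auto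
    then show "0 \<le> inner (0 - b) (p - y)"
      by (simp add: inner_diff_right inner_commute)
  qed
  then show "p \<in> operator_inverse A 0"
    by (simp add: operator_inverse_def)
qed (use assms that in auto)

end

section \<open>The Cauchy problem\<close>

lemma at_within_halfline_neq_bot:
  fixes t :: real
  assumes "t \<ge> 0"
  shows "at t within {0..} \<noteq> bot"
proof -
  have "at_right t \<le> at t within {0..}"
    by (rule at_le) (use assms in auto)
  then show ?thesis
    using trivial_limit_at_right_real[of t] by (metis bot.extremum_uniqueI)
qed

lemma tderiv_eq:
  assumes "(f has_vector_derivative f') (at t within {0..})" "t \<ge> 0"
  shows "tderiv f t = f'"
  unfolding tderiv_def
  by (rule vector_derivative_within[OF at_within_halfline_neq_bot[OF assms(2)] assms(1)])

lemma tderiv_works: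
  assumes "f differentiable_on {0..}" "t \<ge> 0"
  shows "(f has_vector_derivative tderiv f t) (at t within {0..})"
  using assms unfolding tderiv_def differentiable_on_def
  by (simp add: vector_derivative_works[symmetric])

text \<open>Strong measurability comes from composing the continuous \<open>v\<close> with simple
  functions that approximate the identity. Integrability comes from the fundamental theorem of
  calculus for a nonnegative integrand whose primitive has limits at both ends.\<close>

lemma square_integrable_halfline:
  fixes v :: "real \<Rightarrow> 'h::real_normed_vector"
  assumes cont: "continuous_on {0..} v"
    and P: "\<And>t. t \<ge> 0 \<Longrightarrow> (P has_real_derivative (norm (v t))\<^sup>2) (at t within {0..})"
    and Q: "(P \<longlongrightarrow> Q) at_top"
  shows "square_integrable (lebesgue_on {0<..}) v"
  unfolding square_integrable_def
proof
  let ?M = "lebesgue_on {0<..} :: real measure"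
  have "(\<lambda>x. x) \<in> borel_measurable ?M"
    by (intro measurable_restrict_space1 measurable_completion) simp
  then obtain s where s: "\<And>i. simple_function ?M (s i)" "\<And>x. x \<in> space ?M \<Longrightarrow> (\<lambda>i. s i x) \<longlonglongrightarrow> x"
    using borel_measurable_implies_sequence_metric[of "\<lambda>x. x" ?M 0] by metis
  \<comment> \<open>The approximations of \<open>x\<close> may be negative; \<open>max 0\<close>
    keeps them where \<open>v\<close> is continuous.\<close>
  have "(\<lambda>i. v (max 0 (s i x))) \<longlonglongrightarrow> v x" if "x \<in> space ?M" for x
  proof -
    have "(\<lambda>i. max 0 (s i x)) \<longlonglongrightarrow> max 0 x"
      by (intro tendsto_intros s that)
    then have "(\<lambda>i. v (max 0 (s i x))) \<longlonglongrightarrow> v (max 0 x)"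
      by (intro continuous_on_tendsto_compose[OF cont]) auto
    then show ?thesis using that by (simp add: space_restrict_space)
  qed
  moreover have "simple_function ?M (\<lambda>x. v (max 0 (s i x)))" for i
    by (rule simple_function_compose1[OF s(1)])
  ultimately show "strongly_measurable ?M v"
    unfolding strongly_measurable_def
    by (intro exI[of _ "\<lambda>i x. v (max 0 (s i x))"] conjI allI AE_I2)
next
  have "set_integrable lborel (einterval 0 \<infinity>) (\<lambda>t. (norm (v t))\<^sup>2)"
  proof (rule interval_integral_FTC_nonneg)
    fix x :: real assume "0 < ereal x"
    then have x: "0 < x" by simp
    then have at: "at x within {0..} = at x"
      by (intro at_within_interior) auto
    show "(P has_real_derivative (norm (v x))\<^sup>2) (at x)"
      using P[of x] x at by simp
    have "continuous (at x within {0..}) v"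
      using cont x by (simp add: continuous_on_eq_continuous_within)
    then show "isCont (\<lambda>t. (norm (v t))\<^sup>2) x"
      unfolding at by (intro continuous_intros)
  next
    have "(P \<longlongrightarrow> P 0) (at 0 within {0..})"
      using DERIV_continuous[OF P[of 0]] by (simp add: continuous_within)
    then have "(P \<longlongrightarrow> P 0) (at_right 0)"
      by (rule tendsto_within_subset) auto
    then show "((P \<circ> real_of_ereal) \<longlongrightarrow> P 0) (at_right 0)"
      by (simp add: zero_ereal_def ereal_tendsto_simps)
    show "((P \<circ> real_of_ereal) \<longlongrightarrow> Q) (at_left \<infinity>)"
      using Q by (simp add: ereal_tendsto_simps)
  qed auto
  moreover have "einterval 0 \<infinity> = {0<..}"
    by (auto simp: einterval_def)
  ultimately have "integrable lborel (\<lambda>t. indicator {0<..} t *\<^sub>R (norm (v t))\<^sup>2)"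
    by (simp add: set_integrable_def)
  moreover from this have "integrable lebesgue (\<lambda>t. indicator {0<..} t *\<^sub>R (norm (v t))\<^sup>2)"
    by (subst integrable_completion) auto
  ultimately show "integrable (lebesgue_on {0<..}) (\<lambda>t. (norm (v t))\<^sup>2)"
    by (subst integrable_restrict_space) auto
qed

lemma solves_damped_yosidaD:
  assumes "solves_damped_yosida \<gamma> l A u0 v0 u"
  shows "u 0 = u0" "tderiv u 0 = v0"
    "\<And>t. t \<ge> 0 \<Longrightarrow> (u has_vector_derivative tderiv u t) (at t within {0..})"
    "\<And>t. t \<ge> 0 \<Longrightarrow> (tderiv u has_vector_derivative - (\<gamma> *\<^sub>R tderiv u t) - yosida l A (u t)) (at t within {0..})"
proof -
  have u: "u differentiable_on {0..}" "tderiv u differentiable_on {0..}"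
    and eq: "\<And>t. t \<ge> 0 \<Longrightarrow> tderiv (tderiv u) t + \<gamma> *\<^sub>R tderiv u t + yosida l A (u t) = 0"
    using assms by (auto simp: solves_damped_yosida_def C2_halfline_def)
  show "u 0 = u0" "tderiv u 0 = v0"
    using assms by (auto simp: solves_damped_yosida_def)
  show "(u has_vector_derivative tderiv u t) (at t within {0..})" if "t \<ge> 0" for t
    using tderiv_works[OF u(1) that] .
  show "(tderiv u has_vector_derivative - (\<gamma> *\<^sub>R tderiv u t) - yosida l A (u t)) (at t within {0..})" if "t \<ge> 0" for t
  proof -
    have "tderiv (tderiv u) t = - (\<gamma> *\<^sub>R tderiv u t) - yosida l A (u t)"
      using eq[OF that] by (simp add: add.assoc add_eq_0_iff2)
    then show ?thesis
      using tderiv_works[OF u(2) that] by simp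
  qed
qed

text \<open>The equation expresses the second derivative through \<open>u\<close> and
  \<open>v\<close>, and the Lipschitz continuity of the Yosida approximation makes that expression
  continuous, which gives the C2 regularity.\<close>

lemma solves_damped_yosidaI:
  assumes A: "maximal_monotone (A :: 'h::{real_inner,complete_space} \<Rightarrow> 'h set)" and l: "l > 0"
    and init: "u 0 = u0" "v 0 = v0"
    and u': "\<And>t. t \<ge> 0 \<Longrightarrow> (u has_vector_derivative v t) (at t within {0..})"
    and v': "\<And>t. t \<ge> 0 \<Longrightarrow> (v has_vector_derivative - (\<gamma> *\<^sub>R v t) - yosida l A (u t)) (at t within {0..})"
  shows "solves_damped_yosida \<gamma> l A u0 v0 u"
proof -
  have du: "tderiv u t = v t" if "t \<ge> 0" for t
    using tderiv_eq[OF u'] that by blast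
  have du': "(tderiv u has_vector_derivative - (\<gamma> *\<^sub>R v t) - yosida l A (u t)) (at t within {0..})" if "t \<ge> 0" for t
    by (rule has_vector_derivative_transform[OF _ _ v'[OF that]]) (use that du in auto)
  have ddu: "tderiv (tderiv u) t = - (\<gamma> *\<^sub>R v t) - yosida l A (u t)" if "t \<ge> 0" for t
    using tderiv_eq[OF du'] that by blast
  have contY: "continuous_on UNIV (yosida l A)"
    using yosida_lipschitz[OF A l] l
    by (intro lipschitz_on_continuous_on[of "1 / l"] lipschitz_onI) (auto simp: dist_norm)
  have "continuous_on {0..} u" "continuous_on {0..} v"
    using u' v' by (meson atLeast_iff continuous_on_eq_continuous_within has_vector_derivative_continuous)+
  then have "continuous_on {0..} (\<lambda>t. - (\<gamma> *\<^sub>R v t) - yosida l A (u t))"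
    by (intro continuous_intros continuous_on_compose2[OF contY]) auto
  then have "continuous_on {0..} (tderiv (tderiv u))"
    by (rule continuous_on_eq) (simp add: ddu)
  moreover have "u differentiable_on {0..}" "tderiv u differentiable_on {0..}"
    unfolding differentiable_on_def using u' du' by (meson atLeast_iff differentiableI_vector)+
  ultimately show ?thesis
    using init by (simp add: solves_damped_yosida_def C2_halfline_def du ddu)
qed

section \<open>The first-order system for position and velocity\<close>

definition damped_field :: "real \<Rightarrow> real \<Rightarrow> ('h::real_inner \<Rightarrow> 'h set) \<Rightarrow> 'h \<times> 'h \<Rightarrow> 'h \<times> 'h" where
  "damped_field \<gamma> l A p = (snd p, - (\<gamma> *\<^sub>R snd p) - yosida l A (fst p))"

text \<open>Of the constant, 1 comes from the velocity component, \<gamma> from the damping and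
  \<open>1 / l\<close> from the Yosida approximation.\<close>

lemma damped_field_lipschitz:
  fixes A :: "'h::{real_inner,complete_space} \<Rightarrow> 'h set"
  assumes A: "maximal_monotone A" and l: "l > 0" and \<gamma>: "\<gamma> > 0"
  shows "norm (damped_field \<gamma> l A p - damped_field \<gamma> l A q) \<le> (1 + \<gamma> + 1 / l) * norm (p - q)"
proof -
  define x y where "x = fst p - fst q" and "y = snd p - snd q"
  define d where "d = yosida l A (fst p) - yosida l A (fst q)"
  have "norm (damped_field \<gamma> l A p - damped_field \<gamma> l A q) = norm (y, - (\<gamma> *\<^sub>R y) - d)"
    by (simp add: damped_field_def y_def d_def algebra_simps)
  also have "\<dots> \<le> norm y + (norm (- (\<gamma> *\<^sub>R y)) + norm d)"
    using norm_Pair_le[of y "- (\<gamma> *\<^sub>R y) - d"] norm_triangle_ineq4[of "- (\<gamma> *\<^sub>R y)" d] by linarith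
  also have "\<dots> \<le> norm (p - q) + (\<gamma> * norm (p - q) + norm (p - q) / l)"
  proof (intro add_mono)
    show y: "norm y \<le> norm (p - q)"
      using dist_snd_le[of p q] by (simp add: y_def dist_norm)
    show "norm (- (\<gamma> *\<^sub>R y)) \<le> \<gamma> * norm (p - q)"
      using y \<gamma> by simp
    have "norm d \<le> norm x / l"
      unfolding d_def x_def by (rule yosida_lipschitz[OF A l])
    also have "\<dots> \<le> norm (p - q) / l"
      using dist_fst_le[of p q] l by (intro divide_right_mono) (auto simp: x_def dist_norm)
    finally show "norm d \<le> norm (p - q) / l" .
  qed
  finally show ?thesis by (simp add: algebra_simps)
qed

theorem corollary2p3:
  fixes A :: "'h::{real_inner, complete_space} \<Rightarrow> 'h set"
    and \<gamma> l :: real and u0 v0 :: 'h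
  assumes "maximal_monotone A"
    and "\<gamma> > 0" and "l > 0" and "l * \<gamma>\<^sup>2 > 1"
    and "operator_inverse A 0 \<noteq> {}"
  shows "\<exists>u. solves_damped_yosida \<gamma> l A u0 v0 u \<and>
    (\<forall>w. solves_damped_yosida \<gamma> l A u0 v0 w \<longrightarrow> (\<forall>t\<ge>0. w t = u t)) \<and>
    (\<exists>u_inf \<in> operator_inverse A 0. weakly_tendsto u u_inf at_top) \<and>
    square_integrable (lebesgue_on {0<..}) (tderiv u) \<and>
    ((\<lambda>t. norm (tderiv u t)) \<longlongrightarrow> 0) at_top"
proof -
  note lip = damped_field_lipschitz[OF assms(1,3,2)]
  have "1 + \<gamma> + 1 / l > 0"
    using assms by (simp add: add_pos_pos)
  then obtain X where X0: "X 0 = (u0, v0)"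
      and X: "\<And>t. t \<ge> 0 \<Longrightarrow> (X has_vector_derivative damped_field \<gamma> l A (X t)) (at t within {0..})"
    by (rule global_lipschitz_ode_exists[OF lip]) (rule that)
  define u v where "u = (\<lambda>t. fst (X t))" and "v = (\<lambda>t. snd (X t))"
  have u': "(u has_vector_derivative v t) (at t within {0..})" if "t \<ge> 0" for t
    using bounded_linear.has_vector_derivative[OF bounded_linear_fst X[OF that]]
    by (simp add: u_def v_def damped_field_def)
  have v': "(v has_vector_derivative - (\<gamma> *\<^sub>R v t) - yosida l A (u t)) (at t within {0..})" if "t \<ge> 0" for t
    using bounded_linear.has_vector_derivative[OF bounded_linear_snd X[OF that]]
    by (simp add: u_def v_def damped_field_def)
  have u: "solves_damped_yosida \<gamma> l A u0 v0 u"
    by (rule solves_damped_yosidaI[OF assms(1,3) _ _ u' v']) (simp_all add: u_def v_def X0)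
  note u'' = solves_damped_yosidaD[OF u]
  have unique: "w t = u t" if w: "solves_damped_yosida \<gamma> l A u0 v0 w" and "t \<ge> 0" for w t
  proof -
    \<comment> \<open>Any solution, paired with its velocity, is a trajectory of the same Lipschitz
      field from the same initial point.\<close>
    have "(w t, tderiv w t) = X t"
    proof (rule global_lipschitz_ode_unique[OF lip _ X _ \<open>t \<ge> 0\<close>])
      note w' = solves_damped_yosidaD[OF w]
      show "((\<lambda>t. (w t, tderiv w t)) has_vector_derivative damped_field \<gamma> l A (w s, tderiv w s)) (at s within {0..})"
        if "s \<ge> 0" for s
        unfolding damped_field_def using has_vector_derivative_Pair[OF w'(3,4)[OF that]] by simp
      show "(w 0, tderiv w 0) = X 0"
        by (simp add: w' X0)
    qed
    then show ?thesis
      by (metis fst_conv u_def)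
  qed
  obtain z where z: "0 \<in> A z"
    using assms(5) by (auto simp: operator_inverse_def)
  \<comment> \<open>The energy estimates are used with \<open>tderiv u\<close> as the
    velocity.\<close>
  note facts = assms(1,3,2,4) u''(3,4)
  obtain p where p: "p \<in> operator_inverse A 0" "weakly_tendsto u p at_top"
    using damped_trajectory_weakly_convergent[OF facts assms(5)] by blast
  obtain P Q where "(P \<longlongrightarrow> Q) at_top"
      and "\<And>t. t \<ge> 0 \<Longrightarrow> (P has_real_derivative (norm (tderiv u t))\<^sup>2) (at t within {0..})"
    using damped_kinetic_energy_primitive[OF facts z] by blast
  moreover have "continuous_on {0..} (tderiv u)"
    using u''(4) by (meson atLeast_iff continuous_on_eq_continuous_within has_vector_derivative_continuous)
  ultimately have "square_integrable (lebesgue_on {0<..}) (tderiv u)"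
    by (intro square_integrable_halfline)
  moreover have "((\<lambda>t. norm (tderiv u t)) \<longlongrightarrow> 0) at_top"
    by (rule tendsto_norm_zero[OF damped_velocity_tendsto_0[OF facts z]])
  ultimately show ?thesis
    using u unique p by blast
qed

end
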